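(* Let $d\ge 1$, $N=2^d$, and fix a real number $Q>1$. Let $\eta = 1-\frac{N-1}{NQ}$ and let $f:[0,1]\to\mathbb{R}$ be the function with $f(0)=0$, $f(N^{-k}) = Q\eta^k$ for every integer $k\ge 0$, and $f$ affine on each interval $[N^{-k-1},N^{-k}]$, $k\ge 0$. For $(x,y,m)$ with $0\le x\le 1$ and $0<m\le y\le Qm$, define \[ \mathbb{B}(x,y,m)=\sup\Bigl\{\frac{w(E)}{|P|}\Bigr\}, \] where $P$ is a fixed cube in $\mathbb{R}^d$ and the supremum is over all measurable sets $E\subseteq P$ with $|E|=x|P|$ and all weights $w$ on $P$ with $[w]_{A_1^d(P)}\le Q$, $\langle w\rangle_P=y$ and $\operatorname{ess\,inf}_{z\in P}w(z)=m$. Then \[ \mathbb{B}(x,y,m)=m\cdot\begin{cases} x+\frac{y}{m}-1 & \text{if } \frac{y}{m}\le 1+(Q-1)x,\\[1mm] \frac{y/m-1}{Q-1}\, f\Bigl(x\,\frac{Q-1}{y/m-1}\Bigr) & \text{if } \frac{y}{m}\ge 1+(Q-1)x.\end{cases} \]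
   Context: A weight on a cube $P$ is a nonnegative locally integrable function on $P$; $w(E)=\int_E w$, and $\langle g\rangle_R=\frac{1}{|R|}\int_R g$. $\mathcal{D}(P)$ denotes the collection of dyadic subcubes of $P$ (those obtained from $P$ by repeatedly bisecting all sides). The localized dyadic maximal operator is $M^d_P g(z)=\sup_{R\in\mathcal{D}(P),\,z\in R}\langle |g|\rangle_R$, and the dyadic $A_1$ characteristic is $[w]_{A_1^d(P)}=\operatorname{ess\,sup}_{z\in P}\frac{M^d_P w(z)}{w(z)}$. (The value of $\mathbb{B}$ does not depend on the choice of the cube $P$.) Equivalently, $f$ is the piecewise-linear interpolation of $x\mapsto Qx^{\epsilon}$, $\epsilon=-\log(1-\frac{N-1}{NQ})/(d\log 2)$, at the points $N^{-k}$. *)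

theory Defs
  imports "HOL-Analysis.Analysis"
begin

definition cube :: "real^'n \<Rightarrow> real \<Rightarrow> (real^'n) set" where
  "cube a s = {z. \<forall>i. a$i \<le> z$i \<and> z$i \<le> a$i + s}"

definition dyadic_subcubes :: "real^'n \<Rightarrow> real \<Rightarrow> (real^'n) set set" where
  "dyadic_subcubes a s = {R. \<exists>k::nat. \<exists>j::'n \<Rightarrow> nat. (\<forall>i. j i < 2^k) \<and>
      R = cube (\<chi> i. a$i + s * real (j i) / 2^k) (s / 2^k)}"

definition avg :: "(real^'n) set \<Rightarrow> (real^'n \<Rightarrow> real) \<Rightarrow> real" where
  "avg R g = (LINT z:R|lebesgue. g z) / measure lebesgue R"

definition dyadic_max :: "real^'n \<Rightarrow> real \<Rightarrow> (real^'n \<Rightarrow> real) \<Rightarrow> real^'n \<Rightarrow> ereal" where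
  "dyadic_max a s g z = (SUP R\<in>{R\<in>dyadic_subcubes a s. z \<in> R}. ereal (avg R (\<lambda>u. \<bar>g u\<bar>)))"

definition weight_on :: "(real^'n) set \<Rightarrow> (real^'n \<Rightarrow> real) \<Rightarrow> bool" where
  "weight_on P w \<longleftrightarrow> (\<forall>z\<in>P. 0 \<le> w z) \<and> set_integrable lebesgue P w"

text \<open>[w]_{A_1^d(P)} \<le> Q, i.e. ess sup of M^d_P w / w over P is at most Q.\<close>
definition A1_dyadic_le :: "real^'n \<Rightarrow> real \<Rightarrow> (real^'n \<Rightarrow> real) \<Rightarrow> real \<Rightarrow> bool" where
  "A1_dyadic_le a s w Q \<longleftrightarrow>
     (AE z in lebesgue. z \<in> cube a s \<longrightarrow> dyadic_max a s w z \<le> ereal (Q * w z))"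

definition ess_inf_on :: "(real^'n) set \<Rightarrow> (real^'n \<Rightarrow> real) \<Rightarrow> ereal" where
  "ess_inf_on P w = Sup {ereal c | c. AE z in lebesgue. z \<in> P \<longrightarrow> c \<le> w z}"

definition bellman :: "real^'n \<Rightarrow> real \<Rightarrow> real \<Rightarrow> real \<Rightarrow> real \<Rightarrow> real \<Rightarrow> ereal" where
  "bellman a s Q x y m = Sup {ereal ((LINT z:E|lebesgue. w z) / measure lebesgue (cube a s)) | E w.
      E \<in> sets lebesgue \<and> E \<subseteq> cube a s \<and>
      measure lebesgue E = x * measure lebesgue (cube a s) \<and>
      weight_on (cube a s) w \<and> A1_dyadic_le a s w Q \<and>
      avg (cube a s) w = y \<and> ess_inf_on (cube a s) w = ereal m}"

text \<open>The function f: f(0)=0, f(N^-k) = Q eta^k, affine on [N^(-k-1), N^-k].\<close>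
definition fpl :: "nat \<Rightarrow> real \<Rightarrow> real \<Rightarrow> real" where
  "fpl d Q t = (let N = (2::real)^d; \<eta> = 1 - (N - 1) / (N * Q) in
     if t = 0 then 0 else
     (let k = nat \<lfloor>- log N t\<rfloor>; lo = N powr (- real k - 1); hi = N powr (- real k) in
        Q * \<eta>^(Suc k) + (t - lo) / (hi - lo) * (Q * \<eta>^k - Q * \<eta>^(Suc k))))"

end

theory Submission
  imports Defs
begin

text \<open>
  Put \<open>N = 2 ^ d\<close>. The claimed value is the infimum over \<open>k\<close> of
  \<open>\<eta>^k * (y - m + N^k * m * x)\<close>, because \<open>f\<close> is the infimum of the lines
  \<open>t \<mapsto> \<eta>^k * (Q - 1 + N^k * t)\<close>.

  Upper bound: each of these expressions is linear in the data, so it suffices to pass from the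
  children of a cube to the cube. A child whose average \<open>y'\<close> exceeds \<open>Q * m\<close> satisfies
  \<open>w \<ge> y' / Q\<close> by the \<open>A\<^sub>1\<close> condition, and its bound for the larger minimum \<open>y' / Q\<close> is a convex
  combination of two consecutive lines that collapses to the required line for \<open>m\<close>. A general set is
  first enlarged to an open one, which is then exhausted by finite unions of dyadic subcubes.

  Lower bound: weights on the children may be glued whenever the resulting average is at most \<open>Q\<close>
  times the resulting minimum. For \<open>y = Q * m\<close>, let one child carry the same configuration with
  minimum \<open>N * \<eta> * m\<close> and let the weight be \<open>m\<close> on the other children; iterating gives the values
  of \<open>f\<close>. For smaller \<open>y\<close>, interpolate between \<open>y = m\<close> and \<open>y = Q * m\<close> by distributing both
  configurations over the children according to the base-\<open>N\<close> digits of the interpolation parameter.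
\<close>

section \<open>Dyadic subdivision of a cube\<close>

text \<open>A child is indexed by the set \<open>e\<close> of coordinates in which it takes the
  upper half. The index type \<open>'n set\<close> is then finite with exactly 2^d elements, so sums
  over children run over \<open>UNIV\<close>.\<close>

definition child_corner :: "real^'n \<Rightarrow> real \<Rightarrow> 'n set \<Rightarrow> real^'n" where
  "child_corner a s e = (\<chi> i. a$i + (if i \<in> e then s/2 else 0))"

abbreviation child :: "real^'n \<Rightarrow> real \<Rightarrow> 'n set \<Rightarrow> (real^'n) set" where
  "child a s e \<equiv> cube (child_corner a s e) (s/2)"

lemma cube_eq_cbox: "cube a s = cbox a (\<chi> i. a$i + s)"
  by (auto simp: cube_def mem_box_cart)

lemma lmeasurable_cube [simp, intro]: "cube a s \<in> lmeasurable"
  by (simp add: cube_eq_cbox)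

lemma sets_cube [simp, intro]: "cube a s \<in> sets lebesgue"
  using lmeasurable_cube by (rule fmeasurableD)

lemma measure_cube:
  fixes a :: "real^'n"
  assumes "0 \<le> s"
  shows "measure lebesgue (cube a s) = s ^ CARD('n)"
proof -
  have "cube a s \<noteq> {}"
    using assms by (auto simp: cube_def intro!: exI[of _ a])
  then show ?thesis
    unfolding cube_eq_cbox by (simp add: content_cbox_cart)
qed

lemma measure_child:
  fixes a :: "real^'n"
  assumes "0 \<le> s"
  shows "measure lebesgue (child a s e) = measure lebesgue (cube a s) / 2 ^ CARD('n)"
  using assms by (simp add: measure_cube power_divide)

lemma measure_cube_pos: "0 < s \<Longrightarrow> 0 < measure lebesgue (cube a s)"
  by (simp add: measure_cube)

lemma child_subset: "0 \<le> s \<Longrightarrow> child a s e \<subseteq> cube a s"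
proof
  fix z assume s: "0 \<le> s" and z: "z \<in> child a s e"
  have "a$i \<le> z$i \<and> z$i \<le> a$i + s" for i
    using z s by (cases "i \<in> e") (auto simp: cube_def child_corner_def dest!: spec[of _ i])
  then show "z \<in> cube a s" by (simp add: cube_def)
qed

text \<open>Children are closed, hence overlap on faces. The overlaps lie in finitely many
  hyperplanes of measure zero, off which a point of the cube has a unique child; all additivity over
  children rests on this.\<close>

lemma AE_off_midplanes: "AE z in lebesgue. \<forall>i. z$i \<noteq> (a::real^'n)$i + s/2"
proof -
  have "AE z in lebesgue. z$i \<noteq> a$i + s/2" for i
  proof (rule AE_I'[where N = "{z. z$i = a$i + s/2}"])
    show "{z. z$i = a$i + s/2} \<in> null_sets lebesgue"
      using negligible_standard_hyperplane[of "axis i (1::real)" "a$i + s/2"]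
      by (simp add: negligible_iff_null_sets inner_axis axis_in_Basis_iff)
  qed auto
  then show ?thesis
    by (simp add: AE_all_countable)
qed

lemma in_some_child:
  assumes "z \<in> cube a s"
  shows "z \<in> child a s {i. a$i + s/2 \<le> z$i}"
  using assms by (simp add: cube_def child_corner_def) (smt (verit) field_sum_of_halves)

lemma mem_child_iff:
  assumes "z \<in> cube a s" and "\<forall>i. z$i \<noteq> a$i + s/2"
  shows "z \<in> child a s e \<longleftrightarrow> e = {i. a$i + s/2 \<le> z$i}"
proof
  assume "z \<in> child a s e"
  then have "a$i + s/2 \<le> z$i \<longleftrightarrow> i \<in> e" for i
    using assms(2)[rule_format, of i]
    by (auto simp: cube_def child_corner_def split: if_splits dest!: spec[of _ i])
  then show "e = {i. a$i + s/2 \<le> z$i}" by auto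
next
  assume "e = {i. a$i + s/2 \<le> z$i}"
  then show "z \<in> child a s e"
    using in_some_child[OF assms(1)] by simp
qed

lemma Union_child: "0 \<le> s \<Longrightarrow> (\<Union>e. child a s e) = cube a s"
  using in_some_child child_subset by blast

lemma AE_indicator_Union_child:
  fixes a :: "real^'n"
  assumes "0 \<le> s" and E: "\<And>e. E e \<subseteq> child a s e"
  shows "AE z in lebesgue. indicat_real (\<Union>e. E e) z = (\<Sum>e\<in>UNIV. indicat_real (E e) z)"
  using AE_off_midplanes[of a s]
proof eventually_elim
  case (elim z)
  show ?case
  proof (cases "z \<in> cube a s")
    case True
    let ?e = "{i. a$i + s/2 \<le> z$i}"
    have *: "z \<in> E e \<Longrightarrow> e = ?e" for e
      using E mem_child_iff[OF True elim] by blast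
    have "(\<Sum>e\<in>UNIV. indicat_real (E e) z) = (\<Sum>e\<in>{?e}. indicat_real (E e) z)"
      using * by (intro sum.mono_neutral_right) (auto simp: indicator_def)
    also have "\<dots> = indicat_real (\<Union>e. E e) z"
      using * by (auto simp: indicator_def)
    finally show ?thesis by simp
  next
    case False
    then have "z \<notin> E e" for e
      using E child_subset[OF assms(1)] by blast
    then show ?thesis by simp
  qed
qed

lemma set_integral_Union_child:
  fixes a :: "real^'n" and w :: "real^'n \<Rightarrow> real"
  assumes "0 \<le> s" and E: "\<And>e. E e \<subseteq> child a s e" and m: "\<And>e. E e \<in> sets lebesgue"
    and w: "\<And>e. set_integrable lebesgue (child a s e) w"
  shows "set_integrable lebesgue (\<Union>e. E e) w"
    and "(LINT z:(\<Union>e. E e)|lebesgue. w z) = (\<Sum>e\<in>UNIV. LINT z:E e|lebesgue. w z)"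
proof -
  have i: "set_integrable lebesgue (E e) w" for e
    using set_integrable_subset[OF w m E] .
  show u: "set_integrable lebesgue (\<Union>e. E e) w"
    using i m by (intro set_integrable_UN) auto
  have "(LINT z:(\<Union>e. E e)|lebesgue. w z) = (LINT z|lebesgue. (\<Sum>e\<in>UNIV. indicat_real (E e) z *\<^sub>R w z))"
    unfolding set_lebesgue_integral_def
  proof (rule integral_cong_AE)
    show "AE z in lebesgue. indicat_real (\<Union>e. E e) z *\<^sub>R w z = (\<Sum>e\<in>UNIV. indicat_real (E e) z *\<^sub>R w z)"
      using AE_indicator_Union_child[OF assms(1) E]
      by eventually_elim (simp add: sum_distrib_right)
    show "(\<lambda>z. \<Sum>e\<in>UNIV. indicat_real (E e) z *\<^sub>R w z) \<in> borel_measurable lebesgue"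
      using i unfolding set_integrable_def by (intro borel_measurable_sum borel_measurable_integrable) auto
  qed (use u in \<open>simp add: set_integrable_def\<close>)
  also have "\<dots> = (\<Sum>e\<in>UNIV. LINT z:E e|lebesgue. w z)"
    unfolding set_lebesgue_integral_def
    using i by (intro Bochner_Integration.integral_sum) (auto simp: set_integrable_def)
  finally show "(LINT z:(\<Union>e. E e)|lebesgue. w z) = (\<Sum>e\<in>UNIV. LINT z:E e|lebesgue. w z)" .
qed

lemma measure_Union_child:
  fixes a :: "real^'n"
  assumes "0 \<le> s" and E: "\<And>e. E e \<subseteq> child a s e" and m: "\<And>e. E e \<in> sets lebesgue"
  shows "measure lebesgue (\<Union>e. E e) = (\<Sum>e\<in>UNIV. measure lebesgue (E e))"
proof -
  have "set_integrable lebesgue (child a s e) (\<lambda>_. 1::real)" for e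
    using lmeasurable_cube[of "child_corner a s e" "s/2"]
    by (simp add: set_integrable_def fmeasurable_def)
  from set_integral_Union_child(2)[OF assms this]
  show ?thesis using m by (simp add: set_lebesgue_integral_def sets.finite_UN)
qed

section \<open>Dyadic subcubes and inheritance of the A1 condition\<close>

lemma dyadic_subcubesI:
  "\<forall>i. j i < 2^k \<Longrightarrow> cube (\<chi> i. a$i + s * real (j i) / 2^k) (s / 2^k) \<in> dyadic_subcubes a s"
  unfolding dyadic_subcubes_def by blast

lemma dyadic_subcubes_self: "cube a s \<in> dyadic_subcubes a s"
  unfolding dyadic_subcubes_def by (auto intro!: exI[of _ "0::nat"] exI[of _ "\<lambda>_. 0::nat"])

lemma dyadic_subcubes_child:
  fixes a :: "real^'n"
  shows "dyadic_subcubes (child_corner a s e) (s/2) \<subseteq> dyadic_subcubes a s"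
proof
  fix R assume "R \<in> dyadic_subcubes (child_corner a s e) (s/2)"
  then obtain k j where j: "\<forall>i. j i < 2^k"
    and R: "R = cube (\<chi> i. child_corner a s e $ i + s/2 * real (j i) / 2^k) (s/2 / 2^k)"
    unfolding dyadic_subcubes_def by blast
  \<comment> \<open>Measured in steps of \<open>s / 2^Suc k\<close>, the corner of child
    \<open>e\<close> is displaced by \<open>2^k\<close> in the coordinates of
    \<open>e\<close>.\<close>
  let ?j = "\<lambda>i. (if i \<in> e then 2^k else 0) + j i"
  have "\<forall>i. ?j i < 2 ^ Suc k" using j by (auto intro: less_trans[of _ "2^k"])
  moreover have "R = cube (\<chi> i. a $ i + s * real (?j i) / 2^Suc k) (s / 2^Suc k)"
    unfolding R child_corner_def
    by (rule arg_cong2[where f = cube]) (auto simp: vec_eq_iff field_simps)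
  ultimately show "R \<in> dyadic_subcubes a s"
    using dyadic_subcubesI[of ?j "Suc k" a s] by simp
qed

lemma dyadic_subcubes_cases:
  fixes a :: "real^'n"
  assumes "R \<in> dyadic_subcubes a s" and "R \<noteq> cube a s"
  obtains e where "R \<in> dyadic_subcubes (child_corner a s e) (s/2)"
proof -
  obtain k j where j: "\<forall>i. j i < 2^k" and R: "R = cube (\<chi> i. a $ i + s * real (j i) / 2^k) (s / 2^k)"
    using assms(1) unfolding dyadic_subcubes_def by blast
  show thesis
  proof (cases k)
    case 0
    then have "R = cube a s"
      using j unfolding R by (auto simp: vec_eq_iff intro!: arg_cong2[where f = cube])
    with assms(2) show ?thesis by simp
  next
    case (Suc l)
    \<comment> \<open>The leading binary digit of \<open>j i\<close> tells in which half of the cube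
      \<open>R\<close> lies; \<open>?j\<close> removes that digit.\<close>
    let ?e = "{i. 2^l \<le> j i}"
    let ?j = "\<lambda>i. j i - (if i \<in> ?e then 2^l else 0)"
    have "\<forall>i. ?j i < 2 ^ l"
    proof
      fix i show "?j i < 2^l" using j[rule_format, of i] unfolding Suc by auto
    qed
    moreover have "R = cube (\<chi> i. child_corner a s ?e $ i + s/2 * real (?j i) / 2^l) (s/2 / 2^l)"
      unfolding R child_corner_def Suc
      by (rule arg_cong2[where f = cube]) (auto simp: vec_eq_iff field_simps of_nat_diff)
    ultimately show ?thesis
      using that[of ?e] dyadic_subcubesI[of ?j l "child_corner a s ?e" "s/2"] by simp
  qed
qed

lemma dyadic_subcube_subset:
  assumes "R \<in> dyadic_subcubes a s" and "0 \<le> s"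
  shows "R \<subseteq> cube a s"
proof -
  obtain k j where j: "\<forall>i. j i < 2^k" and R: "R = cube (\<chi> i. a $ i + s * real (j i) / 2^k) (s / 2^k)"
    using assms(1) unfolding dyadic_subcubes_def by blast
  have "0 \<le> s * real (j i) / 2^k \<and> s * real (j i) / 2^k + s/2^k \<le> s" for i
  proof -
    have "real (j i) + 1 \<le> 2^k" using j[rule_format, of i]
      by (metis Suc_leI of_nat_Suc of_nat_le_iff of_nat_numeral of_nat_power add.commute)
    then have "s * (real (j i) + 1) \<le> s * 2^k" using assms(2) by (rule mult_left_mono)
    then show ?thesis using assms(2) by (simp add: field_simps)
  qed
  note b = this
  show ?thesis
  proof
    fix z assume "z \<in> R"
    then have "a$i + s * real (j i) / 2^k \<le> z$i \<and> z$i \<le> a$i + s * real (j i) / 2^k + s / 2^k" for i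
      unfolding R cube_def by simp
    then have "a$i \<le> z$i \<and> z$i \<le> a$i + s" for i
      using b[of i] by (smt (verit))
    then show "z \<in> cube a s" by (simp add: cube_def)
  qed
qed

lemma dyadic_subcube_sets: "R \<in> dyadic_subcubes a s \<Longrightarrow> R \<in> sets lebesgue"
  unfolding dyadic_subcubes_def by auto

text \<open>Replacing the supremum by simultaneous bounds over the dyadic cubes through
  \<open>z\<close> gives a form that restricts to children and can be verified cube by cube for a
  glued weight.\<close>

lemma A1_dyadic_le_iff:
  "A1_dyadic_le a s w Q \<longleftrightarrow>
    (AE z in lebesgue. \<forall>R\<in>dyadic_subcubes a s. z \<in> R \<and> z \<in> cube a s \<longrightarrow> avg R (\<lambda>u. \<bar>w u\<bar>) \<le> Q * w z)"
  unfolding A1_dyadic_le_def dyadic_max_def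
  by (rule arg_cong[where f = "\<lambda>P. AE z in lebesgue. P z"]) (auto simp: fun_eq_iff SUP_le_iff)

lemma weight_on_subset:
  "weight_on P w \<Longrightarrow> R \<subseteq> P \<Longrightarrow> R \<in> sets lebesgue \<Longrightarrow> weight_on R w"
  unfolding weight_on_def by (auto intro: set_integrable_subset)

lemma A1_dyadic_le_child:
  assumes "A1_dyadic_le a s w Q" and "0 \<le> s"
  shows "A1_dyadic_le (child_corner a s e) (s/2) w Q"
  using assms(1) unfolding A1_dyadic_le_iff
  by (rule eventually_mono) (use dyadic_subcubes_child[of a s e] child_subset[OF assms(2), of a e] in blast)

lemma avg_abs_weight:
  assumes "weight_on P w" and "R \<subseteq> P"
  shows "avg R (\<lambda>u. \<bar>w u\<bar>) = avg R w"
proof -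
  have "(LINT z:R|lebesgue. \<bar>w z\<bar>) = (LINT z:R|lebesgue. w z)"
    unfolding set_lebesgue_integral_def
    using assms by (intro Bochner_Integration.integral_cong) (auto simp: weight_on_def indicator_def)
  then show ?thesis by (simp add: avg_def)
qed

text \<open>The maximal function is tested on the top cube alone. Applied to a child, this gives the
  improved lower bound for \<open>w\<close> there.\<close>

lemma A1_dyadic_le_imp_avg_le:
  assumes "A1_dyadic_le a s w Q" and "weight_on (cube a s) w"
  shows "AE z in lebesgue. z \<in> cube a s \<longrightarrow> avg (cube a s) w \<le> Q * w z"
  using assms(1) unfolding A1_dyadic_le_iff
  by (rule eventually_mono)
    (use avg_abs_weight[OF assms(2) order_refl] dyadic_subcubes_self[of a s] in auto)

lemma set_integral_ge_const:
  fixes w :: "real^'n \<Rightarrow> real"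
  assumes "set_integrable lebesgue R w" and "R \<in> lmeasurable" and "AE z in lebesgue. z \<in> R \<longrightarrow> m \<le> w z"
  shows "m * measure lebesgue R \<le> (LINT z:R|lebesgue. w z)"
proof -
  have "(LINT z|lebesgue. indicat_real R z * m) \<le> (LINT z|lebesgue. indicat_real R z * w z)"
  proof (rule integral_mono_AE)
    show "AE z in lebesgue. indicat_real R z * m \<le> indicat_real R z * w z"
      using assms(3) by eventually_elim (auto simp: indicator_def)
  qed (use assms in \<open>auto simp: set_integrable_def fmeasurable_def\<close>)
  then show ?thesis
    using assms(2) by (simp add: set_lebesgue_integral_def mult.commute fmeasurable_def)
qed

section \<open>Exhaustion of an open set by dyadic subcubes\<close>

text \<open>This is the union of the generation-\<open>n\<close> subcubes lying in \<open>U\<close>.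
  Recursion through the children, rather than a set comprehension, matches the induction behind the
  upper bound.\<close>

primrec inner_cubes :: "(real^'n) set \<Rightarrow> nat \<Rightarrow> real^'n \<Rightarrow> real \<Rightarrow> (real^'n) set" where
  "inner_cubes U 0 a s = (if cube a s \<subseteq> U then cube a s else {})"
| "inner_cubes U (Suc n) a s = (\<Union>e. inner_cubes U n (child_corner a s e) (s/2))"

lemma inner_cubes_subset: "0 \<le> s \<Longrightarrow> inner_cubes U n a s \<subseteq> cube a s \<inter> U"
proof (induction n arbitrary: a s)
  case (Suc n)
  have "inner_cubes U n (child_corner a s e) (s/2) \<subseteq> cube a s \<inter> U" for e
    using Suc.IH[of "s/2" "child_corner a s e"] child_subset[OF Suc.prems, of a e] Suc.prems by auto
  then show ?case by auto
qed auto

lemma sets_inner_cubes: "inner_cubes U n a s \<in> sets lebesgue"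
  by (induction n arbitrary: a s) auto

text \<open>A generation-\<open>n\<close> subcube containing \<open>z\<close> stays within
  sup-distance \<open>s / 2^n\<close> of \<open>z\<close>.\<close>

lemma inner_cubes_contains:
  assumes "z \<in> cube a s" and "\<And>u. \<forall>i. \<bar>u$i - z$i\<bar> \<le> s / 2^n \<Longrightarrow> u \<in> U"
  shows "z \<in> inner_cubes U n a s"
  using assms
proof (induction n arbitrary: a s)
  case 0
  have "cube a s \<subseteq> U"
  proof
    fix u assume u: "u \<in> cube a s"
    have "\<bar>u$i - z$i\<bar> \<le> s" for i
      using u 0(1) unfolding cube_def mem_Collect_eq by (smt (verit))
    then show "u \<in> U" using 0(2) by simp
  qed
  then show ?case using 0(1) by simp
next
  case (Suc n)
  have "z \<in> inner_cubes U n (child_corner a s {i. a$i + s/2 \<le> z$i}) (s/2)"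
    using Suc.prems by (intro Suc.IH in_some_child) (auto simp: field_simps)
  then show ?case by auto
qed

lemma eventually_in_inner_cubes:
  fixes a :: "real^'n"
  assumes "0 < s" and "open U" and "z \<in> cube a s \<inter> U"
  shows "eventually (\<lambda>n. z \<in> inner_cubes U n a s) sequentially"
proof -
  obtain r where r: "0 < r" "ball z r \<subseteq> U"
    using assms(2,3) open_contains_ball by blast
  \<comment> \<open>The factor \<open>CARD('n)\<close> pays for bounding the Euclidean norm by the
    sum of the coordinate distances.\<close>
  have "(\<lambda>n. real CARD('n) * (s * (1/2)^n)) \<longlonglongrightarrow> real CARD('n) * (s * 0)"
    by (intro tendsto_intros LIMSEQ_realpow_zero) auto
  then have "eventually (\<lambda>n. real CARD('n) * (s * (1/2)^n) < r) sequentially"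
    using r(1) by (intro order_tendstoD) auto
  then show ?thesis
  proof eventually_elim
    case (elim n)
    show ?case
    proof (rule inner_cubes_contains)
      fix u :: "real^'n" assume u: "\<forall>i. \<bar>u$i - z$i\<bar> \<le> s / 2^n"
      have "dist z u \<le> (\<Sum>i\<in>UNIV. \<bar>(z - u)$i\<bar>)"
        unfolding dist_norm by (rule norm_le_l1_cart)
      also have "\<dots> \<le> (\<Sum>i\<in>(UNIV::'n set). s / 2^n)"
        using u by (intro sum_mono) (simp add: abs_minus_commute)
      also have "\<dots> < r" using elim by (simp add: power_one_over)
      finally show "u \<in> U" using r(2) by auto
    qed (use assms in auto)
  qed
qed

section \<open>The upper bound\<close>

text \<open>If a cube has minimum m and average Q m, and all children but one are constantly m, the
  remaining child has average Q N \<eta> m; so N \<eta> is the factor by which its minimum can be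
  raised. The last identity says that the lines with indices k and k + 1 meet at t = N^-(k+1), a
  breakpoint of f.\<close>

lemma bellman_slope_identity:
  fixes N Q \<eta> :: real
  assumes "1 < N" and "1 < Q" and "\<eta> = 1 - (N - 1) / (N * Q)"
  shows "0 < \<eta>" and "\<eta> < 1" and "N * \<eta> = N - (N - 1) / Q" and "1 < N * \<eta>"
    and "(Q - 1) * (1 - \<eta>) = (N * \<eta> - 1) / N"
proof -
  have "N * 1 < N * Q" using assms(1,2) by (intro mult_strict_left_mono) auto
  then have "N - 1 < 1 * (N * Q)" by simp
  then have "(N - 1) / (N * Q) < 1" using assms(1,2) by (subst pos_divide_less_eq) auto
  then show "0 < \<eta>" using assms(3) by simp
  show "\<eta> < 1" using assms by simp
  show e: "N * \<eta> = N - (N - 1) / Q" using assms by (simp add: field_simps)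
  have "(N - 1) * 1 < (N - 1) * Q" using assms(1,2) by (intro mult_strict_left_mono) auto
  then have "(N - 1) / Q < N - 1" using assms(2) by (simp add: pos_divide_less_eq)
  then show "1 < N * \<eta>" using e by simp
  have "N - (N - 1) / Q - 1 = (N - 1) * (Q - 1) / Q" using assms(2) by (simp add: field_simps)
  then show "(Q - 1) * (1 - \<eta>) = (N * \<eta> - 1) / N"
    unfolding e by (simp add: assms(3) mult.commute)
qed

text \<open>
  The lines \<open>\<eta>^k * (Y - M + N^k * m * X)\<close> below are the affine pieces of the concave function \<open>f\<close>,
  made homogeneous in total mass \<open>Y\<close>, minimal mass \<open>M\<close> and measure \<open>X\<close>.
\<close>

lemma bellman_line_full:
  fixes N Q \<eta> :: real
  assumes NQ: "1 < N" "1 < Q" "\<eta> = 1 - (N - 1) / (N * Q)"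
    and "M \<le> Y" and "Y \<le> Q * M" and "0 \<le> M"
  shows "Y \<le> \<eta>^k * (Y - M + N^k * M)"
proof -
  note \<eta> = bellman_slope_identity[OF NQ]
  \<comment> \<open>This is the extreme case \<open>M = 1\<close>, \<open>Y = Q\<close>. From
    \<open>k\<close> to \<open>Suc k\<close> the left side grows by
    \<open>\<eta>^k / N * (N * \<eta> - 1)\<close> and the right side by
    \<open>(N * \<eta>)^k * (N * \<eta> - 1)\<close>, which is larger.\<close>
  have *: "(Q - 1) * (1 - \<eta>^k) \<le> (N * \<eta>)^k - 1"
  proof (induction k)
    case (Suc k)
    have "\<eta>^k / N \<le> 1" using \<eta>(1,2) NQ(1) power_le_one[of \<eta> k] by (simp add: field_simps)
    also have "1 \<le> (N * \<eta>)^k" using \<eta>(4) by (intro one_le_power) auto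
    finally have "\<eta>^k / N * (N * \<eta> - 1) \<le> (N * \<eta>)^k * (N * \<eta> - 1)"
      using \<eta>(4) by (intro mult_right_mono) auto
    moreover have "(Q - 1) * (1 - \<eta>^Suc k) = (Q - 1) * (1 - \<eta>^k) + \<eta>^k * ((Q - 1) * (1 - \<eta>))"
      by (simp add: algebra_simps)
    ultimately show ?case
      using Suc unfolding \<eta>(5) by (simp add: algebra_simps)
  qed simp
  have "(Y - M) * (1 - \<eta>^k) \<le> ((Q - 1) * M) * (1 - \<eta>^k)"
    using \<eta>(1,2) assms(5) power_le_one[of \<eta> k] by (intro mult_right_mono) (auto simp: algebra_simps)
  also have "\<dots> \<le> ((N * \<eta>)^k - 1) * M"
    using mult_right_mono[OF * assms(6)] by (simp add: algebra_simps)
  finally show ?thesis by (simp add: algebra_simps power_mult_distrib)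
qed

text \<open>
  For \<open>k = Suc j\<close> the right-hand side is a convex combination of the hypotheses for \<open>j\<close> and
  \<open>Suc j\<close>; the upper bound on \<open>Y\<close> is what keeps the coefficient \<open>l\<close> nonnegative.
\<close>

lemma bellman_line_raise_min:
  fixes N Q \<eta> :: real
  assumes NQ: "1 < N" "1 < Q" "\<eta> = 1 - (N - 1) / (N * Q)"
    and "0 < c" "0 < m" and Y: "Q * m * c \<le> Y" "Y \<le> m * c * (N * Q - N + 1)"
    and "0 \<le> X" "X \<le> c" and v: "\<And>j. v \<le> \<eta>^j * (Y - Y/Q + N^j * (Y / (Q * c)) * X)"
  shows "v \<le> \<eta>^k * (Y - m * c + N^k * m * X)"
proof (cases k)
  case 0
  \<comment> \<open>For index 0 the bound is Y - m (c - X), which decreases when the minimum is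
    raised because X \<le> c.\<close>
  have "m \<le> Y / (Q * c)" using Y(1) assms(4) NQ(2) by (simp add: field_simps)
  then have "m * (c - X) \<le> Y / (Q * c) * (c - X)"
    using assms(9) by (intro mult_right_mono) auto
  moreover have "Y / (Q * c) * (c - X) = Y / Q - Y / (Q * c) * X"
    using assms(4) NQ(2) by (simp add: field_simps)
  ultimately show ?thesis
    using v[of 0] 0 assms(4) by (simp add: algebra_simps)
next
  case (Suc j)
  note \<eta> = bellman_slope_identity[OF NQ]
  define b where "b = N * \<eta>"
  have b: "1 < b" "b / N = \<eta>" using \<eta>(4) NQ(1) by (auto simp: b_def)
  have bQ: "b * Q = N * Q - N + 1" unfolding b_def \<eta>(3) using NQ(2) by (simp add: field_simps)
  have mc: "0 < m * c" using assms(4,5) by simp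
  have "0 < Q * m * c" using assms(4,5) NQ(2) by simp
  then have Y0: "0 < Y" using Y(1) by simp
  \<comment> \<open>The weight \<open>l\<close> is solved from the coefficient of \<open>X\<close>
    (identity \<open>I1\<close>). It is 1 at the lower bound \<open>Y = Q * m * c\<close> and 0 at
    the upper bound for \<open>Y\<close>.\<close>
  define l where "l = (b * Q * (m * c) / Y - 1) / (b - 1)"
  have l: "l * (b - 1) = b * Q * (m * c) / Y - 1" using b(1) by (simp add: l_def)
  have "Y \<le> b * Q * (m * c)" unfolding bQ using Y(2) by (simp add: mult.commute)
  then have l0: "0 \<le> l" using b(1) Y0 by (simp add: l_def)
  have "b * (Q * m * c) \<le> b * Y" using Y(1) b(1) by (intro mult_left_mono) auto
  then have l1: "l \<le> 1" using b(1) Y0 by (simp add: l_def field_simps)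
  have I1: "Y / (Q * c) * (l * b + (1 - l)) = b * m"
  proof -
    have "l * b + (1 - l) = b * Q * (m * c) / Y" using l by (simp add: algebra_simps)
    then show ?thesis using Y0 assms(4) NQ(2) by simp
  qed
  \<comment> \<open>The same \<open>l\<close> also matches the term free of \<open>X\<close>; this
    is where the crossing identity \<open>\<eta>(5)\<close> enters.\<close>
  have I2: "(Y - Y / Q) * (l * \<eta> + (1 - l)) = \<eta> * (Y - m * c)"
  proof -
    have "Y - Y / Q = Y / Q * (Q - 1)" using NQ(2) by (simp add: field_simps)
    then have "(Y - Y / Q) * (l * \<eta> + (1 - l)) = Y / Q * ((Q - 1) * (l * \<eta> + (1 - l)))"
      by (simp only: mult.assoc)
    also have "(Q - 1) * (l * \<eta> + (1 - l)) = (Q - 1) - l * ((Q - 1) * (1 - \<eta>))"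
      by (simp add: algebra_simps)
    also have "l * ((Q - 1) * (1 - \<eta>)) = (b * Q * (m * c) / Y - 1) / N"
      using l unfolding \<eta>(5) b_def by simp
    also have "Y / Q * ((Q - 1) - (b * Q * (m * c) / Y - 1) / N) = Y * ((Q - 1) / Q + 1 / (N * Q)) - b / N * (m * c)"
      using Y0 NQ by (simp add: field_simps)
    also have "(Q - 1) / Q + 1 / (N * Q) = \<eta>"
      using NQ by (simp add: field_simps)
    finally show ?thesis unfolding b(2) by (simp add: algebra_simps)
  qed
  let ?A = "\<lambda>j. \<eta>^j * (Y - Y/Q + N^j * (Y / (Q * c)) * X)"
  note v' = v
  have "v = l * v + (1 - l) * v" by (simp add: algebra_simps)
  also have "\<dots> \<le> l * ?A (Suc j) + (1 - l) * ?A j"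
    using l0 l1 by (intro add_mono mult_left_mono v') auto
  also have "\<dots> = \<eta>^j * ((Y - Y / Q) * (l * \<eta> + (1 - l)) + N^j * X * (Y / (Q * c) * (l * b + (1 - l))))"
  proof -
    have "l * (\<eta>^Suc j * (u + N^Suc j * q * X)) + (1 - l) * (\<eta>^j * (u + N^j * q * X)) =
      \<eta>^j * (u * (l * \<eta> + (1 - l)) + N^j * X * (q * (l * b + (1 - l))))" for q u
      unfolding b_def by (simp add: algebra_simps)
    then show ?thesis .
  qed
  also have "\<dots> = \<eta>^k * (Y - m * c + N^k * m * X)"
    unfolding I1 I2 unfolding b_def Suc by (simp add: algebra_simps)
  finally show ?thesis .
qed

section \<open>Upper bound for finite unions of cubes, then for measurable sets\<close>

text \<open>The induction must leave \<open>m\<close> and \<open>k\<close> free: a child of large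
  average is treated with a raised minimum and with two neighbouring indices. Accordingly
  \<open>m\<close> is any almost everywhere lower bound, not necessarily the essential
  infimum.\<close>

lemma inner_cubes_weight_le:
  fixes a :: "real^'n" and N Q \<eta> :: real
  assumes N: "N = 2 ^ CARD('n)" and Q: "1 < Q" and \<eta>: "\<eta> = 1 - (N - 1) / (N * Q)"
    and "0 < s" and "weight_on (cube a s) w" and "A1_dyadic_le a s w Q" and "0 < m"
    and "AE z in lebesgue. z \<in> cube a s \<longrightarrow> m \<le> w z"
    and "(LINT z:cube a s|lebesgue. w z) \<le> Q * m * measure lebesgue (cube a s)"
  shows "(LINT z:inner_cubes U n a s|lebesgue. w z) \<le>
    \<eta>^k * ((LINT z:cube a s|lebesgue. w z) - m * measure lebesgue (cube a s)
      + N^k * m * measure lebesgue (inner_cubes U n a s))"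
  using assms(4-)
proof (induction n arbitrary: a s m k)
  have N1: "1 < N" by (simp add: N)
  note \<eta>' = bellman_slope_identity[OF N1 Q \<eta>]
  {
    case 0
    let ?c = "measure lebesgue (cube a s)"
    have "m * ?c \<le> (LINT z:cube a s|lebesgue. w z)"
      using 0 by (intro set_integral_ge_const) (auto simp: weight_on_def)
    then have "(LINT z:cube a s|lebesgue. w z) \<le> \<eta>^k * ((LINT z:cube a s|lebesgue. w z) - m * ?c + N^k * (m * ?c))"
      and "0 \<le> \<eta>^k * ((LINT z:cube a s|lebesgue. w z) - m * ?c)"
      using 0(4,6) measure_cube_pos[OF 0(1), of a] \<eta>'(1)
      by (auto intro!: bellman_line_full[OF N1 Q \<eta>] simp: mult.assoc)
    then show ?case by (auto simp: mult.assoc set_lebesgue_integral_def)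
  next
    case (Suc n)
    note s = Suc.prems(1)
    then have s0: "0 \<le> s" by simp
    let ?c = "measure lebesgue (cube a s) / N"
    let ?I = "\<lambda>e. inner_cubes U n (child_corner a s e) (s/2)"
    let ?w = "\<lambda>E. LINT z:E|lebesgue. w z"
    have c: "measure lebesgue (child a s e) = ?c" for e
      using measure_child[OF s0, of a e] N by simp
    have c0: "0 < ?c" using measure_cube_pos[OF s, of a] N1 by simp
    have wC: "weight_on (child a s e) w" for e
      using weight_on_subset[OF Suc.prems(2) child_subset[OF s0]] by simp
    have iC: "set_integrable lebesgue (child a s e) w" for e
      using wC by (simp add: weight_on_def)
    have IC: "?I e \<subseteq> child a s e" for e
      using inner_cubes_subset[of "s/2" U n "child_corner a s e"] s by auto
    have mC: "AE z in lebesgue. z \<in> child a s e \<longrightarrow> m \<le> w z" for e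
      using Suc.prems(5) by eventually_elim (use child_subset[OF s0, of a e] in blast)
    have lowC: "m * ?c \<le> ?w (child a s e)" for e
      using set_integral_ge_const[OF iC _ mC, of e] c by simp
    have sumw: "?w (cube a s) = (\<Sum>e\<in>UNIV. ?w (child a s e))"
      using set_integral_Union_child(2)[OF s0 order_refl _ iC] Union_child[OF s0, of a] by simp
    have cardN: "real CARD('n set) = N" using N by (simp add: card_UNIV_set)
    \<comment> \<open>The other \<open>N - 1\<close> children carry mass at least
      \<open>m * ?c\<close> each, and the parent carries at most \<open>N * Q * m * ?c\<close>. The
      difference is the upper bound required by \<open>bellman_line_raise_min\<close>.\<close>
    have upC: "?w (child a s e) \<le> m * ?c * (N * Q - N + 1)" for e
    proof -
      have "(\<Sum>e'\<in>UNIV - {e}. m * ?c) \<le> (\<Sum>e'\<in>UNIV - {e}. ?w (child a s e'))"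
        using lowC by (intro sum_mono) auto
      moreover have "(\<Sum>e'\<in>UNIV - {e}. m * ?c) = (N - 1) * (m * ?c)"
      proof -
        have "real (card (UNIV - {e})) = N - 1"
          unfolding cardN[symmetric] by (simp add: card_Diff_singleton of_nat_diff Suc_leI)
        then show ?thesis by (simp only: sum_constant)
      qed
      moreover have "?w (cube a s) = ?w (child a s e) + (\<Sum>e'\<in>UNIV - {e}. ?w (child a s e'))"
        unfolding sumw by (rule sum.remove) auto
      moreover have "?w (cube a s) \<le> N * Q * (m * ?c)"
        using Suc.prems(6) N1 by (simp add: field_simps)
      ultimately have "?w (child a s e) \<le> N * Q * (m * ?c) - (N - 1) * (m * ?c)" by linarith
      also have "\<dots> = m * ?c * (N * Q - N + 1)" by algebra
      finally show ?thesis .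
    qed
    have child_le: "?w (?I e) \<le> \<eta>^k * (?w (child a s e) - m * ?c + N^k * m * measure lebesgue (?I e))" for e
    proof (cases "?w (child a s e) \<le> Q * m * ?c")
      case True
      then show ?thesis
        using Suc.IH[OF _ wC A1_dyadic_le_child[OF Suc.prems(3) s0] Suc.prems(4) mC, of e k] s
        unfolding c by simp
    next
      case False
      let ?Y = "?w (child a s e)"
      \<comment> \<open>The raised minimum is the child's average divided by \<open>Q\<close>, so
        the average equals \<open>Q * ?m\<close> and the induction hypothesis applies with equality
        in its last assumption.\<close>
      let ?m = "?Y / (Q * ?c)"
      have Y0: "0 < ?Y" using False c0 Q Suc.prems(4) by (smt (verit) mult_pos_pos)
      have m0: "0 < ?m" using Y0 c0 Q by (simp only: divide_pos_pos mult_pos_pos less_trans[OF zero_less_one])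
      have mm: "AE z in lebesgue. z \<in> child a s e \<longrightarrow> ?m \<le> w z"
        using A1_dyadic_le_imp_avg_le[OF A1_dyadic_le_child[OF Suc.prems(3) s0] wC, of e]
      proof eventually_elim
        case (elim z)
        show ?case
        proof
          assume "z \<in> child a s e"
          then have "?Y / ?c \<le> Q * w z" using elim unfolding avg_def c by simp
          moreover have "?m = ?Y / ?c / Q" by (simp add: mult.commute)
          moreover have "t / Q \<le> u" if "t \<le> Q * u" for t u
            using that Q by (simp add: pos_divide_le_eq mult.commute)
          ultimately show "?m \<le> w z" by metis
        qed
      qed
      have X: "measure lebesgue (?I e) \<le> ?c"
        using measure_mono_fmeasurable[OF IC[of e] sets_inner_cubes lmeasurable_cube] c by simp
      show ?thesis
      proof (rule bellman_line_raise_min[OF N1 Q \<eta> c0 Suc.prems(4) _ upC _ X])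
        fix j
        have "Q * (u / (Q * c)) * c = u" if "0 < c" for u c :: real
          using that Q by simp
        from this[OF c0, of ?Y] have "?Y \<le> Q * ?m * ?c" by simp
        then have "?w (?I e) \<le> \<eta>^j * (?Y - ?m * ?c + N^j * ?m * measure lebesgue (?I e))"
          using Suc.IH[OF _ wC A1_dyadic_le_child[OF Suc.prems(3) s0] m0 mm, of j] s
          unfolding c by simp
        moreover have "u / (Q * c) * c = u / Q" if "0 < c" for u c :: real
          using that by simp
        from this[OF c0] have "?m * ?c = ?Y / Q" .
        ultimately show "?w (?I e) \<le> \<eta>^j * (?Y - ?Y / Q + N^j * ?m * measure lebesgue (?I e))"
          by simp
      qed (use False in auto)
    qed
    have "?w (inner_cubes U (Suc n) a s) = (\<Sum>e\<in>UNIV. ?w (?I e))"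
      using set_integral_Union_child(2)[OF s0 IC sets_inner_cubes iC] by simp
    also have "\<dots> \<le> (\<Sum>e\<in>UNIV. \<eta>^k * (?w (child a s e) - m * ?c + N^k * m * measure lebesgue (?I e)))"
      by (intro sum_mono child_le)
    also have "\<dots> = \<eta>^k * ((\<Sum>e\<in>UNIV. ?w (child a s e)) - N * (m * ?c) + N^k * m * (\<Sum>e\<in>UNIV. measure lebesgue (?I e)))"
      unfolding cardN[symmetric] sum_distrib_left[symmetric] sum.distrib sum_subtractf by simp
    also have "(\<Sum>e\<in>UNIV. measure lebesgue (?I e)) = measure lebesgue (inner_cubes U (Suc n) a s)"
      using measure_Union_child[OF s0 IC sets_inner_cubes] by simp
    also have "N * (m * ?c) = m * measure lebesgue (cube a s)" using N1 by simp
    finally show ?case unfolding sumw .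
  }
qed

lemma weight_le_bellman_line:
  fixes a :: "real^'n" and N Q \<eta> :: real
  assumes N: "N = 2 ^ CARD('n)" and Q: "1 < Q" and \<eta>: "\<eta> = 1 - (N - 1) / (N * Q)"
    and s: "0 < s" and w: "weight_on (cube a s) w" and A1: "A1_dyadic_le a s w Q" and m: "0 < m"
    and mw: "AE z in lebesgue. z \<in> cube a s \<longrightarrow> m \<le> w z"
    and avg: "(LINT z:cube a s|lebesgue. w z) \<le> Q * m * measure lebesgue (cube a s)"
    and E: "E \<in> sets lebesgue" "E \<subseteq> cube a s"
  shows "(LINT z:E|lebesgue. w z) \<le>
    \<eta>^k * ((LINT z:cube a s|lebesgue. w z) - m * measure lebesgue (cube a s)
      + N^k * m * measure lebesgue E)"
proof (rule field_le_epsilon)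
  fix \<epsilon> :: real assume \<epsilon>: "0 < \<epsilon>"
  have N1: "1 < N" by (simp add: N)
  note \<eta>' = bellman_slope_identity[OF N1 Q \<eta>]
  let ?w = "\<lambda>E. LINT z:E|lebesgue. w z"
  \<comment> \<open>\<open>?K\<close> is the slope of the bound in the measure of the set, so an
    excess measure of \<epsilon> / \<open>?K\<close> costs \<epsilon>.\<close>
  let ?K = "\<eta>^k * (N^k * m)"
  have K: "0 < ?K" using \<eta>'(1) N1 m by simp
  have Em: "E \<in> lmeasurable"
    using fmeasurableI2[OF lmeasurable_cube E(2,1)] .
  obtain U where U: "open U" "E \<subseteq> U" "U - E \<in> lmeasurable" "emeasure lebesgue (U - E) < ennreal (\<epsilon> / ?K)"
    using sets_lebesgue_outer_open[OF E(1), of "\<epsilon> / ?K"] \<epsilon> K by auto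
  have UE: "measure lebesgue (U - E) < \<epsilon> / ?K"
    using U(3,4) \<epsilon> K by (simp add: emeasure_eq_measure2 fmeasurableD2 ennreal_less_iff)
  have iw: "set_integrable lebesgue (cube a s) w" using w by (simp add: weight_on_def)
  let ?V = "cube a s \<inter> U"
  have V: "?V \<in> sets lebesgue" using U(1) by auto
  have iV: "set_integrable lebesgue ?V w" using set_integrable_subset[OF iw V] by simp
  have "measure lebesgue ?V \<le> measure lebesgue (E \<union> (U - E))"
    using Em U(3) V by (intro measure_mono_fmeasurable fmeasurable.Un) auto
  also have "\<dots> \<le> measure lebesgue E + measure lebesgue (U - E)"
    using Em U(3) by (intro measure_Un_le) auto
  finally have V_le: "measure lebesgue ?V \<le> measure lebesgue E + \<epsilon> / ?K" using UE by simp
  let ?B = "\<lambda>x. \<eta>^k * (?w (cube a s) - m * measure lebesgue (cube a s) + N^k * m * x)"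
  have I_le: "?w (inner_cubes U n a s) \<le> ?B (measure lebesgue E) + \<epsilon>" for n
  proof -
    have "measure lebesgue (inner_cubes U n a s) \<le> measure lebesgue ?V"
      using inner_cubes_subset[of s U n a] s sets_inner_cubes fmeasurableI2[OF lmeasurable_cube _ V, of a s]
      by (intro measure_mono_fmeasurable) auto
    then have "?K * measure lebesgue (inner_cubes U n a s) \<le> ?K * (measure lebesgue E + \<epsilon> / ?K)"
      using V_le K by (intro mult_left_mono) auto
    also have "\<dots> = ?K * measure lebesgue E + \<epsilon>"
      using K unfolding distrib_left by (simp only: nonzero_mult_div_cancel_left times_divide_eq_right less_imp_neq[symmetric] if_True simp_thms)
    finally show ?thesis
      using inner_cubes_weight_le[OF N Q \<eta> s w A1 m mw avg, of U n k] by (simp add: algebra_simps)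
  qed
  \<comment> \<open>Each point of \<open>?V\<close> lies in all late approximations, and
    \<open>w\<close> restricted to \<open>?V\<close> dominates.\<close>
  have "(\<lambda>n. ?w (inner_cubes U n a s)) \<longlonglongrightarrow> ?w ?V"
    unfolding set_lebesgue_integral_def
  proof (rule integral_dominated_convergence)
    have sub: "inner_cubes U n a s \<subseteq> ?V" for n using inner_cubes_subset[of s U n a] s by simp
    show "integrable lebesgue (\<lambda>z. \<bar>indicat_real ?V z *\<^sub>R w z\<bar>)"
      using iV unfolding set_integrable_def by (rule integrable_abs)
    show "(\<lambda>z. indicat_real ?V z *\<^sub>R w z) \<in> borel_measurable lebesgue"
      using iV unfolding set_integrable_def by (rule borel_measurable_integrable)
    show "(\<lambda>z. indicat_real (inner_cubes U n a s) z *\<^sub>R w z) \<in> borel_measurable lebesgue" for n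
      using set_integrable_subset[OF iV sets_inner_cubes sub]
      unfolding set_integrable_def by (rule borel_measurable_integrable)
    show "AE z in lebesgue. norm (indicat_real (inner_cubes U n a s) z *\<^sub>R w z) \<le> \<bar>indicat_real ?V z *\<^sub>R w z\<bar>" for n
      using sub[of n] by (intro AE_I2) (auto simp: indicator_def)
    have "(\<lambda>n. indicat_real (inner_cubes U n a s) z *\<^sub>R w z) \<longlonglongrightarrow> indicat_real ?V z *\<^sub>R w z" for z
    proof (cases "z \<in> ?V")
      case True
      have "eventually (\<lambda>n. indicat_real (inner_cubes U n a s) z *\<^sub>R w z = indicat_real ?V z *\<^sub>R w z) sequentially"
        using eventually_in_inner_cubes[OF s U(1) True] by eventually_elim (use True in auto)
      then show ?thesis by (rule tendsto_eventually)
    next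
      case False
      then have "z \<notin> inner_cubes U n a s" for n using sub by blast
      then show ?thesis using False by (simp del: indicator_inter_arith Int_iff)
    qed
    then show "AE z in lebesgue. (\<lambda>n. indicat_real (inner_cubes U n a s) z *\<^sub>R w z) \<longlonglongrightarrow> indicat_real ?V z *\<^sub>R w z"
      by simp
  qed
  then have "?w ?V \<le> ?B (measure lebesgue E) + \<epsilon>"
    by (rule LIMSEQ_le_const2) (use I_le in auto)
  moreover have "?w E \<le> ?w ?V"
    unfolding set_lebesgue_integral_def
    using E U(2) w iV set_integrable_subset[OF iV E(1)]
    by (intro integral_mono) (auto simp: weight_on_def set_integrable_def indicator_def)
  ultimately show "?w E \<le> ?B (measure lebesgue E) + \<epsilon>" by simp
qed

section \<open>Extremal weights\<close>

text \<open>Averages are multiplied out so that they add over children, and the essential infimum is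
  split into a lower bound and its sharpness, which are glued separately. \<open>v\<close> is the
  normalised mass of \<open>E\<close>.\<close>

definition competitor ::
  "real^'n \<Rightarrow> real \<Rightarrow> real \<Rightarrow> real \<Rightarrow> real \<Rightarrow> real \<Rightarrow> real \<Rightarrow> (real^'n) set \<Rightarrow> (real^'n \<Rightarrow> real) \<Rightarrow> bool"
where
  "competitor a s Q x y m v E w \<longleftrightarrow>
      E \<in> sets lebesgue \<and> E \<subseteq> cube a s \<and>
      measure lebesgue E = x * measure lebesgue (cube a s) \<and>
      weight_on (cube a s) w \<and> A1_dyadic_le a s w Q \<and>
      (LINT z:cube a s|lebesgue. w z) = y * measure lebesgue (cube a s) \<and>
      (AE z in lebesgue. z \<in> cube a s \<longrightarrow> m \<le> w z) \<and>
      (\<forall>c>m. \<not> (AE z in lebesgue. z \<in> cube a s \<longrightarrow> c \<le> w z)) \<and>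
      (LINT z:E|lebesgue. w z) = v * measure lebesgue (cube a s)"

definition attained :: "real^'n \<Rightarrow> real \<Rightarrow> real \<Rightarrow> real \<Rightarrow> real \<Rightarrow> real \<Rightarrow> real \<Rightarrow> bool" where
  "attained a s Q x y m v \<longleftrightarrow> (\<exists>E w. competitor a s Q x y m v E w)"

text \<open>Completeness of Lebesgue measure is what makes this true. It is needed because a glued
  weight agrees with its pieces only off the midplanes.\<close>

lemma borel_measurable_lebesgue_cong_AE:
  fixes f g :: "'a::euclidean_space \<Rightarrow> 'b::topological_space"
  assumes "f \<in> borel_measurable lebesgue" and "AE z in lebesgue. f z = g z"
  shows "g \<in> borel_measurable lebesgue"
proof (rule measurableI)
  fix S :: "'b set" assume S: "S \<in> sets borel"
  show "g -` S \<inter> space lebesgue \<in> sets lebesgue"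
  proof (rule completion.in_sets_AE)
    show "AE z in lebesgue. z \<in> f -` S \<inter> space lebesgue \<longleftrightarrow> z \<in> g -` S \<inter> space lebesgue"
      using assms(2) by eventually_elim auto
  qed (use measurable_sets[OF assms(1) S] in auto)
qed simp

lemma not_AE_notin_cube:
  assumes "0 < s"
  shows "\<not> (AE z in lebesgue. z \<notin> cube a s)"
proof
  assume "AE z in lebesgue. z \<notin> cube a s"
  then have "cube a s \<in> null_sets lebesgue"
    by (subst (asm) AE_iff_null_sets[symmetric]) auto
  then have "measure lebesgue (cube a s) = 0" by (simp add: null_sets_def measure_def)
  then show False using measure_cube_pos[OF assms, of a] by simp
qed

lemma attained_const:
  fixes a :: "real^'n"
  assumes "0 < s" and "0 \<le> x" and "x \<le> 1" and "0 < c" and "1 < Q"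
  shows "attained a s Q x c c (c * x)"
proof -
  \<comment> \<open>A cube with this side has measure \<open>x\<close> times that of the large
    cube.\<close>
  let ?r = "s * root CARD('n) x"
  let ?E = "cube a ?r"
  have r: "0 \<le> ?r" "?r \<le> s" using assms by (auto intro!: mult_left_le)
  have "z \<in> cube a s" if "z \<in> ?E" for z
    using that r(2) unfolding cube_def mem_Collect_eq by (meson add_left_mono order_trans)
  then have sub: "?E \<subseteq> cube a s" by blast
  have mE: "measure lebesgue ?E = x * measure lebesgue (cube a s)"
    using assms r(1) by (simp add: measure_cube power_mult_distrib)
  have const: "(LINT z:R|lebesgue. c) = c * measure lebesgue R" if "R \<in> sets lebesgue" for R :: "(real^'n) set"
    using that by (simp add: set_lebesgue_integral_def mult.commute)
  have avg: "avg R (\<lambda>u. \<bar>c\<bar>) \<le> Q * c" if "R \<in> sets lebesgue" for R :: "(real^'n) set"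
    using assms const[OF that] by (simp add: avg_def)
  have "weight_on (cube a s) (\<lambda>_. c)"
    using assms(4) lmeasurable_cube[of a s] by (auto simp: weight_on_def set_integrable_def fmeasurable_def)
  moreover have "A1_dyadic_le a s (\<lambda>_. c) Q"
    unfolding A1_dyadic_le_iff using avg dyadic_subcube_sets by (intro AE_I2) blast
  moreover have "\<not> (AE z in lebesgue. z \<in> cube a s \<longrightarrow> c' \<le> c)" if "c < c'" for c'
    using not_AE_notin_cube[OF assms(1), of a] that by simp
  ultimately show ?thesis
    unfolding attained_def competitor_def using sub mE const
    by (intro exI[of _ ?E] exI[of _ "\<lambda>_. c"]) simp
qed

text \<open>A proper dyadic subcube lies in one child, where the A1 bound is inherited. Only the top
  cube needs a new test, and there \<open>y \<le> Q * m\<close> suffices. The child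
  \<open>e0\<close> makes the minimum \<open>m\<close> sharp.\<close>

lemma attained_glue:
  fixes a :: "real^'n" and N :: real
  assumes N: "N = 2 ^ CARD('n)" and s: "0 < s" and Q: "1 < Q"
    and att: "\<And>e. attained (child_corner a s e) (s/2) Q (X e) (Y e) (M e) (V e)"
    and m: "\<And>e. m \<le> M e" "M e0 = m"
    and y: "(\<Sum>e\<in>UNIV. Y e) = N * y" "y \<le> Q * m"
    and x: "(\<Sum>e\<in>UNIV. X e) = N * x" and v: "(\<Sum>e\<in>UNIV. V e) = N * v"
  shows "attained a s Q x y m v"
proof -
  have N0: "0 < N" by (simp add: N)
  have s0: "0 \<le> s" using s by simp
  have "\<forall>e. \<exists>E W. competitor (child_corner a s e) (s/2) Q (X e) (Y e) (M e) (V e) E W"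
    using att unfolding attained_def by blast
  then obtain E W where C: "\<And>e. competitor (child_corner a s e) (s/2) Q (X e) (Y e) (M e) (V e) (E e) (W e)"
    by metis
  have EW: "E e \<in> sets lebesgue" "E e \<subseteq> child a s e"
      "measure lebesgue (E e) = X e * measure lebesgue (child a s e)"
      "weight_on (child a s e) (W e)" "A1_dyadic_le (child_corner a s e) (s/2) (W e) Q"
      "(LINT z:child a s e|lebesgue. W e z) = Y e * measure lebesgue (child a s e)"
      "AE z in lebesgue. z \<in> child a s e \<longrightarrow> M e \<le> W e z"
      "M e < c \<Longrightarrow> \<not> (AE z in lebesgue. z \<in> child a s e \<longrightarrow> c \<le> W e z)"
      "(LINT z:E e|lebesgue. W e z) = V e * measure lebesgue (child a s e)" for e c
    using C[of e] unfolding competitor_def by blast+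
  \<comment> \<open>Points on a midplane go to the upper child, so \<open>w\<close> is nonnegative
    at every point, as \<open>weight_on\<close> demands.\<close>
  define w where "w z = W {i. a$i + s/2 \<le> z$i} z" for z
  have c: "measure lebesgue (child a s e) = measure lebesgue (cube a s) / N" for e
    using measure_child[OF s0, of a e] N by simp
  have agree: "AE z in lebesgue. \<forall>e. z \<in> child a s e \<longrightarrow> w z = W e z"
    using AE_off_midplanes[of a s]
    by eventually_elim (use mem_child_iff child_subset[OF s0, of a] in \<open>fastforce simp: w_def\<close>)
  have iW: "set_integrable lebesgue (child a s e) (W e)" for e
    using EW(4) by (simp add: weight_on_def)
  have agree_R: "AE z in lebesgue. indicat_real R z *\<^sub>R W e z = indicat_real R z *\<^sub>R w z"
    if "R \<subseteq> child a s e" for R e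
    using agree by eventually_elim (use that in \<open>auto simp: indicator_def\<close>)
  have iw: "set_integrable lebesgue R w" if "R \<subseteq> child a s e" "R \<in> sets lebesgue" for R e
  proof -
    have i: "integrable lebesgue (\<lambda>z. indicat_real R z *\<^sub>R W e z)"
      using set_integrable_subset[OF iW that(2,1)] by (simp add: set_integrable_def)
    have "(\<lambda>z. indicat_real R z *\<^sub>R w z) \<in> borel_measurable lebesgue"
      using borel_measurable_integrable[OF i] agree_R[OF that(1)]
      by (rule borel_measurable_lebesgue_cong_AE)
    then show ?thesis
      unfolding set_integrable_def using integrable_cong_AE_imp[OF i _ agree_R[OF that(1)]] by simp
  qed
  have int_w: "(LINT z:R|lebesgue. w z) = (LINT z:R|lebesgue. W e z)" if "R \<subseteq> child a s e" "R \<in> sets lebesgue" for R e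
    unfolding set_lebesgue_integral_def
    using agree_R[OF that(1)] iw[OF that] set_integrable_subset[OF iW that(2,1)]
    by (intro integral_cong_AE) (auto simp: set_integrable_def)
  have iwC: "set_integrable lebesgue (child a s e) w" for e
    by (rule iw[of _ e]) auto
  have w: "weight_on (cube a s) w"
    using EW(4) in_some_child[of _ a s] set_integral_Union_child(1)[OF s0 order_refl _ iwC] Union_child[OF s0, of a]
    by (auto simp: weight_on_def w_def)
  have wC: "weight_on (child a s e) w" for e
    using weight_on_subset[OF w child_subset[OF s0]] by simp
  have sum_c: "(\<Sum>e\<in>UNIV. f e * (measure lebesgue (cube a s) / N)) = t * measure lebesgue (cube a s)"
    if "(\<Sum>e\<in>UNIV. f e) = N * t" for f :: "'n set \<Rightarrow> real" and t
    unfolding sum_distrib_right[symmetric] that using N0 by simp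
  have mE: "measure lebesgue (\<Union>e. E e) = x * measure lebesgue (cube a s)"
    using measure_Union_child[OF s0 EW(2,1)] EW(3) c sum_c[OF x] by simp
  have wE: "(LINT z:(\<Union>e. E e)|lebesgue. w z) = v * measure lebesgue (cube a s)"
    using set_integral_Union_child(2)[OF s0 EW(2,1) iwC] int_w[OF EW(2,1)] EW(9) c sum_c[OF v] by simp
  have wP: "(LINT z:cube a s|lebesgue. w z) = y * measure lebesgue (cube a s)"
    using set_integral_Union_child(2)[OF s0 order_refl _ iwC] Union_child[OF s0, of a]
      int_w[OF order_refl] EW(6) c sum_c[OF y(1)] by simp
  have mw: "AE z in lebesgue. z \<in> cube a s \<longrightarrow> m \<le> w z"
  proof -
    have "AE z in lebesgue. \<forall>e. z \<in> child a s e \<longrightarrow> M e \<le> W e z"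
      using EW(7) by (simp add: AE_all_countable)
    then show ?thesis
      by eventually_elim (use in_some_child[of _ a s] m(1) in \<open>fastforce simp: w_def intro: order_trans\<close>)
  qed
  have sharp: "\<not> (AE z in lebesgue. z \<in> cube a s \<longrightarrow> c \<le> w z)" if "m < c" for c
  proof
    assume "AE z in lebesgue. z \<in> cube a s \<longrightarrow> c \<le> w z"
    with agree have "AE z in lebesgue. z \<in> child a s e0 \<longrightarrow> c \<le> W e0 z"
      by eventually_elim (use child_subset[OF s0, of a e0] in force)
    then show False using EW(8)[of e0 c] that m(2) by simp
  qed
  have avg_eq: "avg R (\<lambda>u. \<bar>w u\<bar>) = avg R (\<lambda>u. \<bar>W e u\<bar>)"
    if "R \<subseteq> child a s e" "R \<in> sets lebesgue" for R e
    unfolding avg_abs_weight[OF wC that(1)] avg_abs_weight[OF EW(4) that(1)]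
    unfolding avg_def int_w[OF that] ..
  have avgP: "avg (cube a s) (\<lambda>u. \<bar>w u\<bar>) = y"
    using avg_abs_weight[OF w order_refl] wP measure_cube_pos[OF s, of a] by (simp add: avg_def)
  have A1: "A1_dyadic_le a s w Q"
  proof -
    have "AE z in lebesgue. \<forall>e. \<forall>R\<in>dyadic_subcubes (child_corner a s e) (s/2).
        z \<in> R \<and> z \<in> child a s e \<longrightarrow> avg R (\<lambda>u. \<bar>W e u\<bar>) \<le> Q * W e z"
      using EW(5) unfolding A1_dyadic_le_iff by (simp add: AE_all_countable)
    then show ?thesis
      unfolding A1_dyadic_le_iff using agree mw
    proof eventually_elim
      case (elim z)
      show ?case
      proof (intro ballI impI)
        fix R assume R: "R \<in> dyadic_subcubes a s" and z: "z \<in> R \<and> z \<in> cube a s"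
        show "avg R (\<lambda>u. \<bar>w u\<bar>) \<le> Q * w z"
        proof (cases "R = cube a s")
          case True
          have "Q * m \<le> Q * w z" using elim(3) z Q by (intro mult_left_mono) auto
          with y(2) have "y \<le> Q * w z" by (rule order_trans)
          then show ?thesis using True avgP by simp
        next
          case False
          then obtain e where e: "R \<in> dyadic_subcubes (child_corner a s e) (s/2)"
            using dyadic_subcubes_cases[OF R] by blast
          then have Re: "R \<subseteq> child a s e"
            using dyadic_subcube_subset[OF e] s0 by simp
          have "avg R (\<lambda>u. \<bar>W e u\<bar>) \<le> Q * W e z" using elim(1) e z Re by blast
          moreover have "w z = W e z" using elim(2) z Re by blast
          ultimately show ?thesis using avg_eq[OF Re dyadic_subcube_sets[OF e]] by simp
        qed
      qed
    qed
  qed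
  show ?thesis
    unfolding attained_def competitor_def
  proof (intro exI conjI)
    show "(\<Union>e. E e) \<in> sets lebesgue" using EW(1) by auto
    show "(\<Union>e. E e) \<subseteq> cube a s" using EW(2) child_subset[OF s0] by blast
  qed (use mE wE wP w A1 mw sharp in auto)
qed

lemma sum_three_kinds:
  fixes N \<alpha> \<beta> \<gamma> :: real
  assumes "N = 2 ^ CARD('n::finite)" and "e0 \<notin> S"
  shows "(\<Sum>e\<in>(UNIV::'n set set). if e \<in> S then \<alpha> else if e = e0 then \<beta> else \<gamma>)
    = real (card S) * \<alpha> + \<beta> + (N - real (card S) - 1) * \<gamma>"
proof -
  let ?f = "\<lambda>e. if e \<in> S then \<alpha> else if e = e0 then \<beta> else \<gamma>"
  have c: "real CARD('n set) = N" using assms(1) by (simp add: card_UNIV_set)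
  have "sum ?f UNIV = sum ?f (insert e0 S) + sum ?f (- insert e0 S)"
    by (subst sum.union_disjoint[symmetric]) (auto simp: Compl_partition)
  also have "sum ?f (insert e0 S) = \<beta> + real (card S) * \<alpha>"
    using assms(2) by simp
  also have "sum ?f (- insert e0 S) = real (card (- insert e0 S)) * \<gamma>"
    by simp
  also have "real (card (- insert e0 S)) = N - real (card S) - 1"
  proof -
    have "card (insert e0 S) + card (- insert e0 S) = CARD('n set)"
      by (subst card_Un_disjoint[symmetric]) (auto simp: Compl_partition simp del: card_UNIV_set)
    then have "real (card (insert e0 S)) + real (card (- insert e0 S)) = N"
      unfolding c[symmetric] by (metis of_nat_add)
    then show ?thesis using assms(2) by simp
  qed
  finally show ?thesis by simp
qed

text \<open>This is the shape of one base-\<open>N\<close> digit step: \<open>p\<close> children of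
  the first kind, a single one for the remainder, and the rest of the third kind. The disjunction
  guarantees that some child has minimum exactly \<open>m\<close>.\<close>

lemma attained_three_kinds:
  fixes N :: real
  assumes N: "N = 2 ^ CARD('n::finite)" and Q: "1 < Q" and p: "real p \<le> N - 1"
    and s: "0 < s"
    and att1: "\<And>(a::real^'n) s. 0 < s \<Longrightarrow> attained a s Q x1 y1 m1 v1"
    and att2: "\<And>(a::real^'n) s. 0 < s \<Longrightarrow> attained a s Q x2 y2 m2 v2"
    and att3: "\<And>(a::real^'n) s. 0 < s \<Longrightarrow> attained a s Q x3 y3 m3 v3"
    and m: "m \<le> m1" "m \<le> m2" "m \<le> m3" "m2 = m \<or> m3 = m \<and> real p < N - 1"
    and y: "real p * y1 + y2 + (N - real p - 1) * y3 = N * y" "y \<le> Q * m"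
    and x: "real p * x1 + x2 + (N - real p - 1) * x3 = N * x"
    and v: "real p * v1 + v2 + (N - real p - 1) * v3 = N * v"
  shows "attained (a::real^'n) s Q x y m v"
proof -
  have c: "real CARD('n set) = N" using N by (simp add: card_UNIV_set)
  have "real p < real CARD('n set)" using p c by simp
  then have pc: "p < CARD('n set)" by (simp only: of_nat_less_iff)
  obtain S :: "'n set set" where S: "card S = p"
    using obtain_subset_with_card_n[of p "UNIV::'n set set"] pc by auto
  then have "S \<noteq> UNIV" using pc by auto
  then obtain e0 where e0: "e0 \<notin> S" by auto
  define K where "K t1 t2 t3 e = (if e \<in> S then t1 else if e = e0 then t2 else t3)"
    for t1 t2 t3 :: real and e
  have sumK: "(\<Sum>e\<in>UNIV. K t1 t2 t3 e) = real p * t1 + t2 + (N - real p - 1) * t3" for t1 t2 t3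
    unfolding K_def using sum_three_kinds[OF N e0, of t1 t2 t3] S by simp
  have "\<exists>e1. K m1 m2 m3 e1 = m"
  proof (cases "m2 = m")
    case True
    then show ?thesis using e0 by (auto simp: K_def)
  next
    case False
    then have "m3 = m" "real p < N - 1" using m(4) by auto
    then have "real (card (insert e0 S)) < real CARD('n set)" unfolding c using e0 S by simp
    then have "insert e0 S \<noteq> UNIV" by auto
    then obtain e1 where "e1 \<notin> insert e0 S" by auto
    then have "K m1 m2 m3 e1 = m" using \<open>m3 = m\<close> by (auto simp: K_def)
    then show ?thesis ..
  qed
  then obtain e1 where e1: "K m1 m2 m3 e1 = m" ..
  show ?thesis
  proof (rule attained_glue[OF N s Q, where M = "K m1 m2 m3"])
    show "attained (child_corner a s e) (s/2) Q (K x1 x2 x3 e) (K y1 y2 y3 e) (K m1 m2 m3 e) (K v1 v2 v3 e)" for e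
      using att1[of "s/2"] att2[of "s/2"] att3[of "s/2"] s by (simp add: K_def)
    show "m \<le> K m1 m2 m3 e" for e using m by (simp add: K_def)
    show "K m1 m2 m3 e1 = m" by (rule e1)
  qed (use y x v in \<open>simp_all add: sumK\<close>)
qed

lemma attained_two_kinds:
  fixes N :: real
  assumes N: "N = 2 ^ CARD('n::finite)" and Q: "1 < Q" and s: "0 < s"
    and att1: "\<And>(a::real^'n) s. 0 < s \<Longrightarrow> attained a s Q x1 y1 m1 v1"
    and att2: "\<And>(a::real^'n) s. 0 < s \<Longrightarrow> attained a s Q x2 y2 m v2"
    and m: "m \<le> m1"
    and y: "y1 + (N - 1) * y2 = N * y" "y \<le> Q * m"
    and x: "x1 + (N - 1) * x2 = N * x"
    and v: "v1 + (N - 1) * v2 = N * v"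
  shows "attained (a::real^'n) s Q x y m v"
proof -
  have N2: "2 \<le> N" unfolding N using self_le_power[of "2::real" "CARD('n)"] by simp
  \<comment> \<open>Take \<open>p = 0\<close>, with the first configuration on the single child and
    the second on the \<open>N - 1\<close> others.\<close>
  show ?thesis
    by (rule attained_three_kinds[OF N Q _ s att1 att1 att2, of 0]) (use N2 m y x v in auto)
qed

section \<open>Explicit configurations and interpolation between them\<close>

text \<open>The hypotheses place \<open>x\<close> between N^-(k+1) and N^-k. While
  \<open>N * x \<le> 1\<close> the whole set fits into the one distinguished child, where it has
  density \<open>N * x\<close>; hence the index drops by one.\<close>

lemma attained_power_chain:
  fixes N Q \<eta> :: real and a :: "real^'n"
  assumes N: "N = 2 ^ CARD('n)" and Q: "1 < Q" and \<eta>: "\<eta> = 1 - (N - 1) / (N * Q)"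
    and "0 < s" and "0 < m" and "1 \<le> N^Suc k * x" and "N^k * x \<le> 1"
  shows "attained a s Q x (Q * m) m (m * (\<eta>^k * (Q - 1 + N^k * x)))"
  using assms(4-)
proof (induction k arbitrary: a s m x)
  have N2: "2 \<le> N" unfolding N using self_le_power[of "2::real" "CARD('n)"] by simp
  then have N1: "1 < N" by simp
  note \<eta>' = bellman_slope_identity[OF N1 Q \<eta>]
  have bQ: "Q * (N * \<eta>) = N * Q - N + 1" unfolding \<eta>'(3) using Q by (simp add: field_simps)
  {
    case 0
    \<comment> \<open>For index 0 the set fills the distinguished child, and \<open>?x\<close> is
      its density in each of the others.\<close>
    let ?x = "(N * x - 1) / (N - 1)"
    have x: "0 \<le> ?x" "?x \<le> 1" using 0 N1 by (auto simp: divide_le_eq)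
    have M: "0 < m * (Q * (N * \<eta>))" "m \<le> m * (Q * (N * \<eta>))"
    proof -
      have "1 * 1 \<le> Q * (N * \<eta>)" using Q \<eta>'(4) by (intro mult_mono) auto
      then show "0 < m * (Q * (N * \<eta>))" "m \<le> m * (Q * (N * \<eta>))"
        using 0(2) mult_left_mono[of 1 "Q * (N * \<eta>)" m] by auto
    qed
    have att1: "attained a s Q 1 (m * (Q * (N * \<eta>))) (m * (Q * (N * \<eta>))) (m * (Q * (N * \<eta>)) * 1)"
        if "0 < s" for a :: "real^'n" and s
      using that M Q by (intro attained_const) auto
    have att2: "attained a s Q ?x m m (m * ?x)" if "0 < s" for a :: "real^'n" and s
      using that x 0(2) Q by (intro attained_const) auto
    have x': "(N - 1) * ?x = N * x - 1" using N1 by simp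
    show ?case
    proof (rule attained_two_kinds[OF N Q 0(1) att1 att2 M(2)])
      show "m * (Q * (N * \<eta>)) * 1 + (N - 1) * (m * ?x) = N * (m * (\<eta> ^ 0 * (Q - 1 + N ^ 0 * x)))"
        unfolding bQ power_0 using x' by algebra
      show "m * (Q * (N * \<eta>)) + (N - 1) * m = N * (Q * m)" unfolding bQ by algebra
      show "1 + (N - 1) * ?x = N * x" unfolding x' by simp
    qed simp_all
  next
    case (Suc k)
    let ?b = "N * \<eta>"
    have M: "0 < m * ?b" "m \<le> m * ?b" using Suc.prems(2) \<eta>'(4) by auto
    have att1: "attained a s Q (N * x) (Q * (m * ?b)) (m * ?b) (m * ?b * (\<eta>^k * (Q - 1 + N^k * (N * x))))"
      if "0 < s" for a :: "real^'n" and s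
      using that M Suc.prems by (intro Suc.IH) (auto simp: mult_ac)
    have att2: "attained a s Q 0 m m (m * 0)" if "0 < s" for a :: "real^'n" and s
      using that Suc.prems(2) Q by (intro attained_const) auto
    show ?case
    proof (rule attained_two_kinds[OF N Q Suc.prems(1) att1 att2 M(2)])
      have "Q * (m * ?b) = m * (N * Q - N + 1)" using bQ by (simp add: mult_ac)
      then show "Q * (m * ?b) + (N - 1) * m = N * (Q * m)" by algebra
      show "m * ?b * (\<eta>^k * (Q - 1 + N^k * (N * x))) + (N - 1) * (m * 0) =
          N * (m * (\<eta>^Suc k * (Q - 1 + N^Suc k * x)))"
        by (simp add: mult_ac)
    qed auto
  }
qed

text \<open>One child is raised just enough to reach average \<open>y\<close>, and the set has
  density \<open>x\<close> in every child. This crude value starts the interpolation and settles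
  \<open>x = 0\<close>.\<close>

lemma attained_proportional:
  fixes N Q :: real and a :: "real^'n"
  assumes N: "N = 2 ^ CARD('n)" and Q: "1 < Q" and s: "0 < s" and m: "0 < m"
    and x: "0 \<le> x" "x \<le> 1" and y: "m \<le> y" "y \<le> Q * m"
  shows "attained a s Q x y m (y * x)"
proof -
  let ?c = "m + N * (y - m)"
  have "0 \<le> N * (y - m)" using y(1) N by (intro mult_nonneg_nonneg) auto
  then have c: "m \<le> ?c" by simp
  have att1: "attained a s Q x ?c ?c (?c * x)" if "0 < s" for a :: "real^'n" and s
    using that x c m Q by (intro attained_const) auto
  have att2: "attained a s Q x m m (m * x)" if "0 < s" for a :: "real^'n" and s
    using that x m Q by (intro attained_const) auto
  show ?thesis
  proof (rule attained_two_kinds[OF N Q s att1 att2 c])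
    show "?c * x + (N - 1) * (m * x) = N * (y * x)" by algebra
    show "?c + (N - 1) * m = N * y" by algebra
    show "x + (N - 1) * x = N * x" by algebra
  qed (use y in auto)
qed

text \<open>Each digit of \<open>h\<close> is realised exactly by whole children; only the single
  remainder child carries an error. Its relative volume is 1/N, so every further digit divides the
  error by \<open>N\<close>.\<close>

lemma attained_near_concave:
  fixes N Q :: real and a :: "real^'n"
  assumes N: "N = 2 ^ CARD('n)" and Q: "1 < Q" and m: "0 < m"
    and att0: "\<And>(a::real^'n) s. 0 < s \<Longrightarrow> attained a s Q x0 y0 m v0"
    and att1: "\<And>(a::real^'n) s. 0 < s \<Longrightarrow> attained a s Q x1 y1 m v1"
    and y: "m \<le> y0" "y0 \<le> Q * m" "m \<le> y1" "y1 \<le> Q * m"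
    and x: "0 \<le> x0" "x0 \<le> 1" "0 \<le> x1" "x1 \<le> 1"
    and h: "0 \<le> h" "h \<le> 1"
  shows "\<exists>v \<ge> (1 - h) * v0 + h * v1 - (\<bar>v0\<bar> + \<bar>v1\<bar>) / N^n.
    \<forall>(a::real^'n) s. 0 < s \<longrightarrow> attained a s Q ((1 - h) * x0 + h * x1) ((1 - h) * y0 + h * y1) m v"
  using h
proof (induction n arbitrary: h)
  have N2: "2 \<le> N" unfolding N using self_le_power[of "2::real" "CARD('n)"] by simp
  then have N1: "1 < N" by simp
  have conv: "(1 - h) * t0 + h * t1 \<le> B" if "t0 \<le> B" "t1 \<le> B" "0 \<le> h" "h \<le> 1" for h t0 t1 B :: real
    using convex_bound_le[OF that(1,2), of "1 - h" h] that(3,4) by simp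
  {
    case 0
    let ?x = "(1 - h) * x0 + h * x1" and ?y = "(1 - h) * y0 + h * y1"
    have X: "0 \<le> ?x" "?x \<le> 1" using x 0 by (auto intro!: conv)
    have Y: "m \<le> ?y" "?y \<le> Q * m"
      using conv[of "- y0" "- m" "- y1" h] y 0 by (auto intro!: conv)
    have att: "attained a s Q ?x ?y m (?y * ?x)" if "0 < s" for a :: "real^'n" and s
      using attained_proportional[OF N Q that m X Y] .
    \<comment> \<open>With no digits used, the allowed error already exceeds the target, so any
      nonnegative value will do.\<close>
    have "(1 - h) * v0 + h * v1 \<le> \<bar>v0\<bar> + \<bar>v1\<bar>" using 0 by (intro conv) auto
    moreover have "0 \<le> ?y * ?x" using X Y(1) m by (intro mult_nonneg_nonneg) auto
    ultimately show ?case using att by (intro exI[of _ "?y * ?x"]) auto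
  next
    case (Suc n)
    show ?case
    proof (cases "h = 1")
      \<comment> \<open>For \<open>h = 1\<close> the digit would be \<open>N\<close>, leaving no
        child for the remainder.\<close>
      case True
      then show ?thesis using att1 N1 by (intro exI[of _ v1]) auto
    next
      case False
      \<comment> \<open>\<open>p\<close> is the leading base-\<open>N\<close> digit of
        \<open>h\<close>, and \<open>g\<close> is the parameter left for the remainder
        child.\<close>
      define p where "p = nat \<lfloor>N * h\<rfloor>"
      define g where "g = N * h - real p"
      have pf: "real p = of_int \<lfloor>N * h\<rfloor>" unfolding p_def using Suc.prems N1 by simp
      have g: "0 \<le> g" "g \<le> 1" unfolding g_def pf by linarith+
      have "N * h < N * 1" using False Suc.prems N1 by (intro mult_strict_left_mono) auto
      moreover have "real p \<le> N * h" unfolding pf by simp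
      ultimately have "real p < N" by simp
      then have "Suc p \<le> 2 ^ CARD('n)"
        unfolding N Suc_le_eq by (metis of_nat_less_iff of_nat_numeral of_nat_power)
      then have "real (Suc p) \<le> real (2 ^ CARD('n))" by (simp only: of_nat_le_iff)
      then have p: "real p \<le> N - 1" using N by simp
      have gp: "N * h = real p + g" by (simp add: g_def)
      obtain v where v: "v \<ge> (1 - g) * v0 + g * v1 - (\<bar>v0\<bar> + \<bar>v1\<bar>) / N^n"
        and att: "\<And>(a::real^'n) s. 0 < s \<Longrightarrow> attained a s Q ((1 - g) * x0 + g * x1) ((1 - g) * y0 + g * y1) m v"
        using Suc.IH[OF g] by blast
      let ?v = "(real p * v1 + v + (N - real p - 1) * v0) / N"
      have lin: "real p * t1 + ((1 - g) * t0 + g * t1) + (N - real p - 1) * t0 = N * ((1 - h) * t0 + h * t1)"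
        for t0 t1 using gp by algebra
      have "attained a s Q ((1 - h) * x0 + h * x1) ((1 - h) * y0 + h * y1) m ?v" if "0 < s" for a :: "real^'n" and s
        by (rule attained_three_kinds[OF N Q p that att1 att att0])
          (use y Suc.prems N1 in \<open>auto simp: lin intro!: conv\<close>)
      moreover have "(1 - h) * v0 + h * v1 - (\<bar>v0\<bar> + \<bar>v1\<bar>) / N^Suc n \<le> ?v"
      proof -
        have "N * ((1 - h) * v0 + h * v1) - (\<bar>v0\<bar> + \<bar>v1\<bar>) / N^n \<le> real p * v1 + v + (N - real p - 1) * v0"
          using v unfolding lin[symmetric] by simp
        then have "(N * ((1 - h) * v0 + h * v1) - (\<bar>v0\<bar> + \<bar>v1\<bar>) / N^n) / N \<le> ?v"
          using N1 by (intro divide_right_mono) auto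
        then show ?thesis using N1 by (simp add: diff_divide_distrib mult.commute)
      qed
      ultimately show ?thesis by blast
    qed
  }
qed

section \<open>The Bellman function\<close>

lemma ess_inf_on_eqD:
  assumes "ess_inf_on P w = ereal m"
  shows "AE z in lebesgue. z \<in> P \<longrightarrow> m \<le> w z"
proof -
  have "AE z in lebesgue. z \<in> P \<longrightarrow> m - 1 / real (Suc n) \<le> w z" for n
  proof -
    have "ereal (m - 1 / real (Suc n)) < ess_inf_on P w" using assms by simp
    then obtain c where c: "m - 1 / real (Suc n) < c" "AE z in lebesgue. z \<in> P \<longrightarrow> c \<le> w z"
      unfolding ess_inf_on_def less_Sup_iff by auto
    then show ?thesis by (auto elim: eventually_mono)
  qed
  then have "AE z in lebesgue. \<forall>n. z \<in> P \<longrightarrow> m - 1 / real (Suc n) \<le> w z"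
    unfolding AE_all_countable by blast
  then show ?thesis
  proof eventually_elim
    case (elim z)
    show ?case
    proof
      assume z: "z \<in> P"
      have "(\<lambda>n. m - 1 / real (Suc n)) \<longlonglongrightarrow> m - 0"
        by (intro tendsto_diff tendsto_const LIMSEQ_Suc lim_1_over_n)
      then show "m \<le> w z"
        using LIMSEQ_le_const2[of "\<lambda>n. m - 1 / real (Suc n)" m "w z"] elim z by auto
    qed
  qed
qed

lemma ess_inf_on_eqI:
  assumes "AE z in lebesgue. z \<in> P \<longrightarrow> m \<le> w z"
    and "\<And>c. m < c \<Longrightarrow> \<not> (AE z in lebesgue. z \<in> P \<longrightarrow> c \<le> w z)"
  shows "ess_inf_on P w = ereal m"
  unfolding ess_inf_on_def
proof (rule antisym)
  show "Sup {ereal c |c. AE z in lebesgue. z \<in> P \<longrightarrow> c \<le> w z} \<le> ereal m"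
    by (rule Sup_least) (use assms(2) in \<open>auto simp: not_less[symmetric]\<close>)
  show "ereal m \<le> Sup {ereal c |c. AE z in lebesgue. z \<in> P \<longrightarrow> c \<le> w z}"
    by (rule Sup_upper) (use assms(1) in auto)
qed

lemma attained_le_bellman:
  assumes "0 < s" and "attained a s Q x y m v"
  shows "ereal v \<le> bellman a s Q x y m"
proof -
  obtain E w where "competitor a s Q x y m v E w"
    using assms(2) unfolding attained_def by blast
  then have C: "E \<in> sets lebesgue" "E \<subseteq> cube a s"
      "measure lebesgue E = x * measure lebesgue (cube a s)"
      "weight_on (cube a s) w" "A1_dyadic_le a s w Q"
      "(LINT z:cube a s|lebesgue. w z) = y * measure lebesgue (cube a s)"
      "AE z in lebesgue. z \<in> cube a s \<longrightarrow> m \<le> w z"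
      "\<And>c. m < c \<Longrightarrow> \<not> (AE z in lebesgue. z \<in> cube a s \<longrightarrow> c \<le> w z)"
      "(LINT z:E|lebesgue. w z) = v * measure lebesgue (cube a s)"
    unfolding competitor_def by blast+
  have c: "0 < measure lebesgue (cube a s)" by (rule measure_cube_pos[OF assms(1)])
  have "avg (cube a s) w = y" using C(6) c by (simp add: avg_def)
  moreover have "v = (LINT z:E|lebesgue. w z) / measure lebesgue (cube a s)" using C(9) c by simp
  ultimately show ?thesis
    unfolding bellman_def using C(1-5) ess_inf_on_eqI[OF C(7,8)]
    by (intro Sup_upper CollectI exI[of _ E] exI[of _ w]) simp
qed

lemma bellman_le_line:
  fixes a :: "real^'n" and N Q \<eta> :: real
  assumes N: "N = 2 ^ CARD('n)" and Q: "1 < Q" and \<eta>: "\<eta> = 1 - (N - 1) / (N * Q)"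
    and s: "0 < s" and m: "0 < m" and y: "y \<le> Q * m"
  shows "bellman a s Q x y m \<le> ereal (\<eta>^k * (y - m + N^k * m * x))"
  unfolding bellman_def
proof (rule Sup_least, clarify)
  fix E and w :: "real^'n \<Rightarrow> real"
  let ?c = "measure lebesgue (cube a s)"
  assume E: "E \<in> sets lebesgue" "E \<subseteq> cube a s" "measure lebesgue E = x * ?c"
    and w: "weight_on (cube a s) w" "A1_dyadic_le a s w Q"
    and yw: "y = avg (cube a s) w" and inf: "ess_inf_on (cube a s) w = ereal m"
  have c: "0 < ?c" by (rule measure_cube_pos[OF s])
  have I: "(LINT z:cube a s|lebesgue. w z) = y * ?c" using yw c by (simp add: avg_def)
  have "y * ?c \<le> Q * m * ?c" using y c by (intro mult_right_mono) auto
  then have "(LINT z:E|lebesgue. w z) \<le> \<eta>^k * (y * ?c - m * ?c + N^k * m * (x * ?c))"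
    using weight_le_bellman_line[OF N Q \<eta> s w m ess_inf_on_eqD[OF inf] _ E(1,2), of k] E(3) I by simp
  also have "\<dots> = \<eta>^k * (y - m + N^k * m * x) * ?c" by (simp add: algebra_simps)
  finally show "ereal ((LINT z:E|lebesgue. w z) / ?c) \<le> ereal (\<eta>^k * (avg (cube a s) w - m + N^k * m * x))"
    using c yw by (simp add: pos_divide_le_eq)
qed

section \<open>Affine pieces of f\<close>

text \<open>The drop of f over one interval is \<eta>^k (N - 1) / N, and the interval has length
  N^-k (N - 1) / N, so the slope is \<eta>^k N^k.\<close>

lemma fpl_eq_line:
  fixes N Q \<eta> :: real
  assumes "0 < d" and N: "N = 2 ^ d" and Q: "1 < Q" and \<eta>: "\<eta> = 1 - (N - 1) / (N * Q)"
    and t: "t \<noteq> 0" and k: "k = nat \<lfloor>- log N t\<rfloor>"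
  shows "fpl d Q t = \<eta>^k * (Q - 1 + N^k * t)"
proof -
  have N1: "1 < N" using assms(1) by (simp add: N)
  have hi: "N powr (- real k) = 1 / N^k"
    using N1 by (simp add: powr_minus powr_realpow divide_inverse)
  have lo: "N powr (- real k - 1) = 1 / N^k / N"
    using N1 hi by (simp add: powr_diff)
  define u where "u = 1 / N^k"
  have u: "0 < u" "u * N^k = 1" using N1 by (auto simp: u_def)
  have gap: "u - u / N = u * (N - 1) / N" using N1 by (simp add: field_simps)
  have "Q * \<eta>^k - Q * \<eta>^Suc k = \<eta>^k * (Q * (1 - \<eta>))" by (simp add: algebra_simps)
  also have "Q * (1 - \<eta>) = (N - 1) / N" using Q unfolding \<eta> by simp
  finally have drop: "Q * \<eta>^k - Q * \<eta>^Suc k = \<eta>^k * ((N - 1) / N)" .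
  have "(t - u / N) / (u - u / N) * (Q * \<eta>^k - Q * \<eta>^Suc k) = \<eta>^k * ((t - u / N) / u)"
    unfolding gap drop using N1 u(1) by simp
  also have "(t - u / N) / u = N^k * t - 1 / N" using N1 by (simp add: u_def field_simps)
  finally have "(t - u / N) / (u - u / N) * (Q * \<eta>^k - Q * \<eta>^Suc k) = \<eta>^k * (N^k * t - 1 / N)" .
  moreover have "Q * \<eta>^Suc k = \<eta>^k * (Q - 1 + 1 / N)"
  proof -
    have "Q * \<eta> = Q - 1 + 1 / N" unfolding \<eta> using Q N1 by (simp add: field_simps)
    then show ?thesis by simp
  qed
  moreover have "fpl d Q t = Q * \<eta>^Suc k + (t - u / N) / (u - u / N) * (Q * \<eta>^k - Q * \<eta>^Suc k)"
    unfolding fpl_def Let_def N[symmetric] \<eta>[symmetric] k[symmetric] hi lo u_def using t by simp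
  ultimately show ?thesis by (simp add: algebra_simps)
qed

text \<open>The index chosen in \<open>fpl\<close> is the one for which
  \<open>attained_power_chain\<close> applies; \<open>t \<le> 1\<close> makes the floor nonnegative,
  so \<open>nat\<close> does not change it.\<close>

lemma nat_floor_log_bounds:
  fixes N t :: real
  assumes "1 < N" and "0 < t" and "t \<le> 1" and k: "k = nat \<lfloor>- log N t\<rfloor>"
  shows "1 \<le> N^Suc k * t" and "N^k * t \<le> 1"
proof -
  have "0 \<le> - log N t" using assms by (simp add: log_le_zero_cancel_iff)
  then have rk: "real k = of_int \<lfloor>- log N t\<rfloor>" using k by simp
  have T: "t = N powr (log N t)" using assms by simp
  have "N^Suc k * t = N powr (real (Suc k) + log N t)"
    using assms(1) T by (metis powr_add powr_realpow less_trans zero_less_one)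
  moreover have "0 \<le> real (Suc k) + log N t" using rk by simp linarith
  ultimately show "1 \<le> N^Suc k * t" using assms(1) by (simp add: ge_one_powr_ge_zero)
  have "N^k * t = N powr (real k + log N t)"
    using assms(1) T by (metis powr_add powr_realpow less_trans zero_less_one)
  moreover have "real k + log N t \<le> 0" using rk by linarith
  ultimately show "N^k * t \<le> 1"
    using assms(1) powr_mono[of "real k + log N t" 0 N] by simp
qed

theorem mainTheorem1:
  fixes a :: "real^'n" and s Q x y m :: real
  assumes "0 < s" and "1 < Q" and "0 \<le> x" and "x \<le> 1"
    and "0 < m" and "m \<le> y" and "y \<le> Q * m"
  shows "bellman a s Q x y m =
    ereal (m * (if y / m \<le> 1 + (Q - 1) * x then x + y / m - 1
                else (y / m - 1) / (Q - 1) * fpl CARD('n) Q (x * (Q - 1) / (y / m - 1))))"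
proof -
  define N :: real where "N = 2 ^ CARD('n)"
  define \<eta> where "\<eta> = 1 - (N - 1) / (N * Q)"
  \<comment> \<open>\<open>h\<close> is the interpolation parameter from \<open>m\<close> to
    \<open>Q * m\<close> that gives \<open>y\<close>; the case distinction of the theorem compares
    \<open>h\<close> with \<open>x\<close>.\<close>
  define h where "h = (y / m - 1) / (Q - 1)"
  have N1: "1 < N" by (simp add: N_def)
  note \<eta>' = bellman_slope_identity[OF N1 assms(2) \<eta>_def]
  note Q = assms(2) and m = assms(5)
  have yh: "y = m * (1 + (Q - 1) * h)" using Q m by (simp add: h_def)
  have h: "0 \<le> h" "h \<le> 1" using assms by (auto simp: h_def field_simps)
  have y_conv: "(1 - h) * m + h * (Q * m) = y" unfolding yh by (simp add: algebra_simps)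
  have le_line: "bellman a s Q x y m \<le> ereal (\<eta>^k * (y - m + N^k * m * x))" for k
    using bellman_le_line[OF N_def Q \<eta>_def assms(1) m assms(7)] .
  \<comment> \<open>The interpolation error tends to zero, so the supremum dominates the exact
    convex combination even where it need not be attained.\<close>
  have near: "ereal ((1 - h) * v0 + h * v1) \<le> bellman a s Q ((1 - h) * x0 + h * x1) y m"
    if ends: "\<And>(a::real^'n) s. 0 < s \<Longrightarrow> attained a s Q x0 m m v0"
      "\<And>(a::real^'n) s. 0 < s \<Longrightarrow> attained a s Q x1 (Q * m) m v1"
      "0 \<le> x0" "x0 \<le> 1" "0 \<le> x1" "x1 \<le> 1" for x0 x1 v0 v1
  proof (rule LIMSEQ_le_const2)
    let ?f = "\<lambda>n. (1 - h) * v0 + h * v1 - (\<bar>v0\<bar> + \<bar>v1\<bar>) * (1 / N)^n"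
    have "?f \<longlonglongrightarrow> (1 - h) * v0 + h * v1 - (\<bar>v0\<bar> + \<bar>v1\<bar>) * 0"
      by (intro tendsto_intros LIMSEQ_realpow_zero) (use N1 in auto)
    then show "(\<lambda>n. ereal (?f n)) \<longlonglongrightarrow> ereal ((1 - h) * v0 + h * v1)"
      by (intro tendsto_ereal) simp
    have "ereal (?f n) \<le> bellman a s Q ((1 - h) * x0 + h * x1) y m" for n
    proof -
      have b: "m \<le> Q * m" using Q m by simp
      obtain v where v: "v \<ge> (1 - h) * v0 + h * v1 - (\<bar>v0\<bar> + \<bar>v1\<bar>) / N^n"
        and att: "attained a s Q ((1 - h) * x0 + h * x1) y m v"
        using attained_near_concave[OF N_def Q m ends(1,2) order_refl b b order_refl ends(3-6) h, of n]
          assms(1) unfolding y_conv by blast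
      have "ereal (?f n) \<le> ereal v" using v by (simp add: power_one_over)
      also have "\<dots> \<le> bellman a s Q ((1 - h) * x0 + h * x1) y m"
        by (rule attained_le_bellman[OF assms(1) att])
      finally show ?thesis .
    qed
    then show "\<exists>n0. \<forall>n\<ge>n0. ereal (?f n) \<le> bellman a s Q ((1 - h) * x0 + h * x1) y m" by blast
  qed
  have attm: "attained a s Q t m m (m * t)" if "0 < s" "0 \<le> t" "t \<le> 1" for a :: "real^'n" and s t
    using attained_const[OF that(1-3) m Q] .
  have chain: "attained a s Q t (Q * m) m (m * (\<eta>^k * (Q - 1 + N^k * t)))"
    if "0 < s" "0 < t" "t \<le> 1" "k = nat \<lfloor>- log N t\<rfloor>" for a :: "real^'n" and s t k
    using attained_power_chain[OF N_def Q \<eta>_def that(1) m nat_floor_log_bounds[OF N1 that(2-4)]] .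
  show ?thesis
  proof (cases "y / m \<le> 1 + (Q - 1) * x")
    case True
    have "h \<le> x" unfolding h_def using True Q by (subst pos_divide_le_eq) (auto simp: mult.commute)
    have G: "m * (x + y / m - 1) = m * x + y - m" using m by (simp add: field_simps)
    have "ereal (m * x + y - m) \<le> bellman a s Q x y m"
    proof (cases "h = 1")
      case True
      then have x1: "x = 1" and yQ: "y = Q * m" using \<open>h \<le> x\<close> assms(4) yh by auto
      show ?thesis
        using attained_le_bellman[OF assms(1) chain[OF assms(1), of 1 0]] N1 x1 yQ by (simp add: mult.commute)
    next
      case False
      \<comment> \<open>The set fills the part of average \<open>Q * m\<close> entirely; what
        remains of \<open>x\<close> has density \<sigma> in the part with constant weight
        \<open>m\<close>.\<close>
      define \<sigma> where "\<sigma> = (x - h) / (1 - h)"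
      have \<sigma>: "0 \<le> \<sigma>" "\<sigma> \<le> 1" "(1 - h) * \<sigma> + h * 1 = x"
        using False h \<open>h \<le> x\<close> assms(4) by (auto simp: \<sigma>_def divide_le_eq)
      have att1: "attained a s Q 1 (Q * m) m (m * Q)" if "0 < s" for a :: "real^'n" and s
        using chain[OF that, of 1 0] by simp
      have "(1 - h) * (m * \<sigma>) + h * (m * Q) = m * ((1 - h) * \<sigma> + h * 1) + y - m"
        unfolding yh by (simp add: algebra_simps)
      then show ?thesis
        using near[OF attm att1, of \<sigma>] \<sigma> by simp
    qed
    moreover have "bellman a s Q x y m \<le> ereal (m * x + y - m)"
      using le_line[of 0] by (simp add: algebra_simps)
    ultimately show ?thesis unfolding G[symmetric] using True by (simp add: antisym)
  next
    case False
    have "x < h" unfolding h_def using False Q by (subst pos_less_divide_eq) (auto simp: mult.commute)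
    then have h0: "0 < h" using assms(3) by simp
    have t: "x * (Q - 1) / (y / m - 1) = x / h" using Q by (simp add: h_def)
    have "bellman a s Q x y m = ereal (m * (h * fpl CARD('n) Q (x / h)))"
    proof (cases "x = 0")
      case True
      have "ereal (y * x) \<le> bellman a s Q x y m"
        using attained_le_bellman[OF assms(1) attained_proportional[OF N_def Q assms(1) m assms(3,4,6,7)]] .
      then have "ereal 0 \<le> bellman a s Q x y m" using True by simp
      \<comment> \<open>Every line is an upper bound, and at \<open>x = 0\<close> the lines tend to
        zero as the index grows.\<close>
      moreover have "bellman a s Q x y m \<le> ereal 0"
      proof (rule LIMSEQ_le_const)
        have "(\<lambda>k. \<eta>^k * (y - m)) \<longlonglongrightarrow> 0 * (y - m)"
          by (intro tendsto_intros LIMSEQ_realpow_zero) (use \<eta>' in auto)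
        then show "(\<lambda>k. ereal (\<eta>^k * (y - m))) \<longlonglongrightarrow> ereal 0"
          by (intro tendsto_ereal) simp
        show "\<exists>n0. \<forall>n\<ge>n0. bellman a s Q x y m \<le> ereal (\<eta>^n * (y - m))"
          using le_line True by simp
      qed
      ultimately show ?thesis using True by (simp add: fpl_def zero_ereal_def)
    next
      case False
      define k where "k = nat \<lfloor>- log N (x / h)\<rfloor>"
      have x0: "0 < x" using False assms(3) by simp
      have T: "0 < x / h" "x / h \<le> 1" using x0 h0 \<open>x < h\<close> by auto
      have f: "fpl CARD('n) Q (x / h) = \<eta>^k * (Q - 1 + N^k * (x / h))"
        by (rule fpl_eq_line[OF _ N_def Q \<eta>_def]) (use T k_def in auto)
      have hx: "h * (x / h) = x" using h0 by simp
      have val: "m * (h * fpl CARD('n) Q (x / h)) = \<eta>^k * (y - m + N^k * m * x)"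
      proof -
        have "m * (h * (\<eta>^k * (Q - 1 + N^k * \<tau>))) = \<eta>^k * (y - m + N^k * m * (h * \<tau>))" for \<tau>
          unfolding yh by (simp add: algebra_simps)
        from this[of "x / h"] show ?thesis unfolding f hx .
      qed
      \<comment> \<open>Now \<open>x < h\<close>, so the whole set is put into the part of average
        \<open>Q * m\<close>, with density \<open>x / h\<close> there.\<close>
      have "ereal ((1 - h) * (m * 0) + h * (m * (\<eta>^k * (Q - 1 + N^k * (x / h))))) \<le>
          bellman a s Q ((1 - h) * 0 + h * (x / h)) y m"
        by (rule near[OF attm chain]) (use T k_def in auto)
      then have "ereal (m * (h * fpl CARD('n) Q (x / h))) \<le> bellman a s Q x y m"
        unfolding f hx by (simp add: mult.left_commute)
      then show ?thesis using le_line[of k] unfolding val by (rule antisym[rotated])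
    qed
    then show ?thesis using False unfolding t h_def[symmetric] by simp
  qed
qed

end
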